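(* Let $A$ be an $n\times n$ symmetric matrix with entries in a field $\mathbb{F}$. Then either (1) the matrix $A$ is irreducible and the fiber of $A$ consists of all matrices that are diagonally equivalent to $A$, or (2) the matrix $A$ can be written as a completely reducible matrix with $s$ diagonal blocks $A_1,\dots,A_s$ that are irreducible, and the fiber of $A$ in $\mathbb{F}^{n\times n}$ consists of all matrices that can be written as block upper triangular matrices with $s$ irreducible diagonal blocks that are diagonally equivalent to the diagonal blocks of $A$.
   Context: The principal minor map sends $A\in\mathbb{F}^{n\times n}$ to the vector of its principal minors $(\det A[S,S])_{S\subseteq\{1,\dots,n\}}$ (with entry $1$ for $S=\emptyset$), where $A[S,S]$ is the submatrix with rows and columns indexed by $S$; the fiber of $A$ is the set of all matrices in $\mathbb{F}^{n\times n}$ with the same principal minors as $A$. Two matrices $A$ and $B$ are diagonally equivalent if there exists an invertible diagonal matrix $D$ such that $A=DBD^{-1}$ or $A=DB^TD^{-1}$. "Can be written as" means after permuting some rows and the corresponding columns. A matrix is reducible if it can be written as a block upper triangular matrix (with at least two diagonal blocks); otherwise it is irreducible. A matrix is completely reducible if it can be written as a block diagonal matrix with each diagonal block irreducible.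
   Formalization: In (2) each diagonal block of a matrix in the fiber must occupy the same rows and columns of the matrix, in the same order, as the diagonally equivalent block of A; with unrelated permutations the claim fails, e.g. diag(0,1) and diag(1,0). Case (2) is stated with s at least 2. *)

theory Defs
  imports
    "Jordan_Normal_Form.Determinant"
    "Jordan_Normal_Form.DL_Submatrix"
begin

text \<open>
  Rows and columns of an \<open>n \<times> n\<close> matrix are indexed by \<open>{..<n}\<close>. The determinant of the
  \<open>0 \<times> 0\<close> matrix is \<open>1\<close>, so the principal minor for the empty set is \<open>1\<close>.
\<close>

definition principal_minor_map :: "'a :: field mat \<Rightarrow> nat set \<Rightarrow> 'a" where
  "principal_minor_map A = (\<lambda>S \<in> Pow {..<dim_row A}. det (submatrix A S S))"

definition fiber :: "'a :: field mat \<Rightarrow> 'a mat set" where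
  "fiber A = {B \<in> carrier_mat (dim_row A) (dim_col A).
     principal_minor_map B = principal_minor_map A}"

definition diagonally_equivalent :: "'a :: field mat \<Rightarrow> 'a mat \<Rightarrow> bool" where
  "diagonally_equivalent A B \<longleftrightarrow>
     (\<exists>n D E. {A, B, D, E} \<subseteq> carrier_mat n n \<and> diagonal_mat D \<and>
        inverts_mat D E \<and> inverts_mat E D \<and>
        (A = D * B * E \<or> A = D * transpose_mat B * E))"

definition permute_rows_cols :: "(nat \<Rightarrow> nat) \<Rightarrow> 'a mat \<Rightarrow> 'a mat" where
  "permute_rows_cols p A = mat (dim_row A) (dim_col A) (\<lambda>(i, j). A $$ (p i, p j))"

text \<open>Diagonal blocks are always square and nonempty.\<close>

definition proper_blocks :: "'a mat list \<Rightarrow> bool" where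
  "proper_blocks Bs \<longleftrightarrow> (\<forall>B \<in> set Bs. square_mat B \<and> 0 < dim_row B)"

text \<open>
  \<open>block_upper_triangular Bs M\<close>: \<open>M\<close> is block upper triangular with diagonal blocks \<open>Bs\<close>, from
  the top left to the bottom right. The recursion follows that of \<^const>\<open>diag_block_mat\<close>, with an
  arbitrary upper right block.
\<close>

fun block_upper_triangular :: "'a :: zero mat list \<Rightarrow> 'a mat \<Rightarrow> bool" where
  "block_upper_triangular [] M \<longleftrightarrow> M \<in> carrier_mat 0 0"
| "block_upper_triangular (B # Bs) M \<longleftrightarrow>
     (\<exists>X N. block_upper_triangular Bs N \<and> X \<in> carrier_mat (dim_row B) (dim_col N) \<and>
        M = four_block_mat B X (0\<^sub>m (dim_row N) (dim_col B)) N)"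

definition reducible_mat :: "'a :: zero mat \<Rightarrow> bool" where
  "reducible_mat A \<longleftrightarrow> square_mat A \<and>
     (\<exists>p Bs. p permutes {..<dim_row A} \<and> 2 \<le> length Bs \<and> proper_blocks Bs \<and>
        block_upper_triangular Bs (permute_rows_cols p A))"

definition irreducible_mat :: "'a :: zero mat \<Rightarrow> bool" where
  "irreducible_mat A \<longleftrightarrow> square_mat A \<and> \<not> reducible_mat A"

definition block_offset :: "'a mat list \<Rightarrow> nat \<Rightarrow> nat" where
  "block_offset Bs i = sum_list (map dim_row (take i Bs))"

text \<open>
  If \<open>A\<close> is written with diagonal blocks \<open>As\<close> by means of \<open>p\<close>, and \<open>B\<close> with diagonal blocks \<open>Bs\<close>
  by means of \<open>q\<close>, then \<open>blocks_at_same_indices p As \<tau> q Bs\<close> says that \<open>Bs ! i\<close> occupies in \<open>B\<close>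
  exactly the rows and columns that \<open>As ! \<tau> i\<close> occupies in \<open>A\<close>, in the same order. Diagonal
  equivalence of the blocks is meaningful for the fiber only with this matching: permuting the
  rows and columns of a matrix arbitrarily does not preserve its principal minors, e.g. the
  diagonal matrices with diagonals \<open>(0, 1)\<close> and \<open>(1, 0)\<close> lie in different fibers. The order \<open>\<tau>\<close>
  of the blocks has to depend on \<open>B\<close>.
\<close>

definition blocks_at_same_indices ::
  "(nat \<Rightarrow> nat) \<Rightarrow> 'a mat list \<Rightarrow> (nat \<Rightarrow> nat) \<Rightarrow> (nat \<Rightarrow> nat) \<Rightarrow> 'a mat list \<Rightarrow> bool" where
  "blocks_at_same_indices p As \<tau> q Bs \<longleftrightarrow>
     (\<forall>i < length Bs. dim_row (Bs ! i) = dim_row (As ! \<tau> i) \<and>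
        (\<forall>r < dim_row (Bs ! i). q (block_offset Bs i + r) = p (block_offset As (\<tau> i) + r)))"

end

theory Submission
  imports Defs
begin

text \<open>
  The principal minors of a symmetric matrix \<open>A\<close> determine all cycle products of any matrix \<open>B\<close> in
  its fiber: \<open>B v\<^sub>0 v\<^sub>1 * B v\<^sub>1 v\<^sub>2 * \<dots> * B v\<^sub>k v\<^sub>0\<close> equals the corresponding product for \<open>A\<close>
  (\<open>cycle_prod_eq_simple\<close>). This goes by induction on the length. The minors of size one and two give
  the loops and the two-cycles. A longer cycle with a chord \<open>u v\<close> splits into two shorter cycles, and
  \<open>B u v * B v u = A u v * A u v\<close> relates the three products. For a chordless cycle, the only terms of
  the determinant that are not already known come from the cycle and from its reverse; if \<open>P\<close> and
  \<open>P'\<close> are their products in \<open>B\<close> and \<open>c\<close> is their common product in \<open>A\<close>, then \<open>P + P' = c + c\<close> and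
  \<open>P * P' = c * c\<close>, so \<open>P\<close> is the double root \<open>c\<close> of \<open>x\<^sup>2 - 2 c x + c\<^sup>2\<close>. The symmetry of \<open>A\<close> enters
  here, and the argument works in every characteristic.

  A closed walk decomposes into cycles, so the products along closed walks agree as well
  (\<open>walk_prod_eq_closed\<close>). Two consequences describe \<open>B\<close>. Inside a connected component of the
  graph of \<open>A\<close>, scaling by the quotient of the products of \<open>A\<close> and \<open>B\<close> along a walk from a fixed
  root turns \<open>A\<close> into \<open>B\<close> (\<open>same_minors_scaling\<close>). Between components, a closed walk of nonzero
  entries of \<open>B\<close> is also one of \<open>A\<close>, so the strongly connected components of \<open>B\<close> are the connected
  components of \<open>A\<close> (\<open>strongly_connected_same_minors\<close>), and ordering them by reachability makes \<open>B\<close>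
  block upper triangular.

  Conversely, a permutation that contributes to a minor of a block triangular matrix maps each block
  to itself, and on the diagonal blocks the scaling factors cancel along every permutation
  (\<open>same_minors_triangular\<close>).
\<close>

section \<open>Products along walks\<close>

fun walk_prod :: "(nat \<Rightarrow> nat \<Rightarrow> 'a :: comm_monoid_mult) \<Rightarrow> nat list \<Rightarrow> 'a" where
  "walk_prod M (x # y # zs) = M x y * walk_prod M (y # zs)"
| "walk_prod M _ = 1"

definition cycle_prod :: "(nat \<Rightarrow> nat \<Rightarrow> 'a :: comm_monoid_mult) \<Rightarrow> nat list \<Rightarrow> 'a" where
  "cycle_prod M xs = walk_prod M (xs @ [hd xs])"

lemma walk_prod_split: "walk_prod M (xs @ v # ys) = walk_prod M (xs @ [v]) * walk_prod M (v # ys)"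
proof (induction xs)
  case Nil
  then show ?case by (cases ys) auto
next
  case (Cons x xs)
  then show ?case by (cases xs) (auto simp: mult.assoc)
qed

lemma cycle_prod_rotate: "cycle_prod M (xs @ ys) = cycle_prod M (ys @ xs)"
proof (cases "xs = [] \<or> ys = []")
  case False
  then obtain x xs' y ys' where xy: "xs = x # xs'" "ys = y # ys'"
    by (meson neq_Nil_conv)
  have "cycle_prod M (xs @ ys) = walk_prod M ((x # xs') @ y # (ys' @ [x]))"
    by (simp add: cycle_prod_def xy)
  also have "\<dots> = walk_prod M ((x # xs') @ [y]) * walk_prod M ((y # ys') @ [x])"
    by (subst walk_prod_split) simp
  also have "\<dots> = walk_prod M ((y # ys') @ x # (xs' @ [y]))"
    by (subst walk_prod_split[of M "y # ys'" x "xs' @ [y]"]) (simp add: mult.commute)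
  finally show ?thesis
    by (simp add: cycle_prod_def xy)
qed auto

lemma walk_prod_rev: "walk_prod M (rev xs) = walk_prod (\<lambda>i j. M j i) xs"
proof (induction xs rule: induct_list012)
  case (3 x y zs)
  have "walk_prod M (rev (x # y # zs)) = walk_prod M (rev zs @ y # [x])"
    by simp
  also have "\<dots> = walk_prod M (rev (y # zs)) * M y x"
    by (subst walk_prod_split) simp
  finally show ?case
    using 3 by (simp add: mult.commute)
qed auto

lemma walk_prod_mult: "walk_prod M xs * walk_prod N xs = walk_prod (\<lambda>i j. M i j * N i j) xs"
  by (induction xs rule: induct_list012) (auto simp: ac_simps)

lemma walk_prod_cong:
  assumes "set xs \<subseteq> X" and "\<And>i j. i \<in> X \<Longrightarrow> j \<in> X \<Longrightarrow> M i j = N i j"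
  shows "walk_prod M xs = walk_prod N xs"
  using assms(1) by (induction xs rule: induct_list012) (auto simp: assms(2))

lemma walk_prod_nth: "walk_prod M xs = (\<Prod>i<length xs - 1. M (xs ! i) (xs ! Suc i))"
proof (induction xs rule: induct_list012)
  case (3 x y zs)
  then show ?case
    by (simp add: prod.lessThan_Suc_shift del: prod.lessThan_Suc)
qed auto

lemma cycle_prod_nth:
  "cycle_prod M xs = (\<Prod>i<length xs. M (xs ! i) (xs ! (Suc i mod length xs)))"
proof (cases "xs = []")
  case False
  have "cycle_prod M xs = (\<Prod>i<length xs. M ((xs @ [hd xs]) ! i) ((xs @ [hd xs]) ! Suc i))"
    by (simp add: cycle_prod_def walk_prod_nth)
  also have "\<dots> = (\<Prod>i<length xs. M (xs ! i) (xs ! (Suc i mod length xs)))"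
  proof (rule prod.cong)
    fix i assume i: "i \<in> {..<length xs}"
    show "M ((xs @ [hd xs]) ! i) ((xs @ [hd xs]) ! Suc i) = M (xs ! i) (xs ! (Suc i mod length xs))"
      using i False by (cases "Suc i = length xs") (auto simp: nth_append hd_conv_nth)
  qed simp
  finally show ?thesis .
qed (simp add: cycle_prod_def)

section \<open>Determinants of chordless cycles\<close>

text \<open>
  An involution consists of fixed points and two-cycles, so its term of the determinant is determined
  by the minors of size at most two.
\<close>

lemma prod_involution:
  fixes M N :: "nat \<Rightarrow> nat \<Rightarrow> 'a :: comm_monoid_mult"
  assumes f: "f permutes S" and fin: "finite S" and invol: "\<And>i. i \<in> S \<Longrightarrow> f (f i) = i"
    and diag: "\<And>i. i \<in> S \<Longrightarrow> M i i = N i i"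
    and two: "\<And>i j. i \<in> S \<Longrightarrow> j \<in> S \<Longrightarrow> i \<noteq> j \<Longrightarrow> M i j * M j i = N i j * N j i"
  shows "(\<Prod>i\<in>S. M i (f i)) = (\<Prod>i\<in>S. N i (f i))"
proof -
  let ?U = "{i\<in>S. i < f i}" and ?D = "{i\<in>S. f i < i}" and ?E = "{i\<in>S. f i = i}"
  have fS: "f i \<in> S" if "i \<in> S" for i
    using f that by (simp add: permutes_in_image)
  have split: "(\<Prod>i\<in>S. g i (f i)) = (\<Prod>i\<in>?U. g i (f i) * g (f i) i) * (\<Prod>i\<in>?E. g i i)"
    for g :: "nat \<Rightarrow> nat \<Rightarrow> 'a"
  proof -
    have S: "S = (?U \<union> ?D) \<union> ?E"
      by auto
    have "(\<Prod>i\<in>S. g i (f i)) = (\<Prod>i\<in>?U. g i (f i)) * (\<Prod>i\<in>?D. g i (f i)) * (\<Prod>i\<in>?E. g i (f i))"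
      using fin by (subst S, subst prod.union_disjoint, simp, simp, force,
          subst prod.union_disjoint) auto
    also have "(\<Prod>i\<in>?D. g i (f i)) = (\<Prod>i\<in>?U. g (f i) i)"
      by (rule prod.reindex_bij_witness[where i = f and j = f]) (auto simp: invol fS)
    finally show ?thesis
      by (simp add: prod.distrib)
  qed
  have "(\<Prod>i\<in>?U. M i (f i) * M (f i) i) = (\<Prod>i\<in>?U. N i (f i) * N (f i) i)"
    by (rule prod.cong) (auto simp: fS intro!: two)
  moreover have "(\<Prod>i\<in>?E. M i i) = (\<Prod>i\<in>?E. N i i)"
    by (rule prod.cong) (auto simp: diag)
  ultimately show ?thesis
    using split[of M] split[of N] by simp
qed

definition cyc_shift :: "nat \<Rightarrow> nat \<Rightarrow> nat" where
  "cyc_shift k i = (if i < k then Suc i mod k else i)"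

lemma cyc_shift_permutes: "cyc_shift k permutes {..<k}"
proof (rule bij_imp_permutes)
  have inj: "inj_on (cyc_shift k) {..<k}"
    by (rule inj_onI) (auto simp: cyc_shift_def mod_Suc split: if_splits)
  moreover have "cyc_shift k ` {..<k} \<subseteq> {..<k}"
    by (auto simp: cyc_shift_def)
  ultimately show "bij_betw (cyc_shift k) {..<k} {..<k}"
    by (simp add: bij_betw_def endo_inj_surj)
qed (simp add: cyc_shift_def)

text \<open>The shift acts transitively, so a set that it preserves is everything once it is nonempty.\<close>

lemma cyc_shift_closed:
  assumes i: "i \<in> T" "i < k" and step: "\<And>i. i \<in> T \<Longrightarrow> i < k \<Longrightarrow> cyc_shift k i \<in> T"
  shows "{..<k} \<subseteq> T"
proof -
  have up: "j \<in> T" if "j0 \<in> T" "j0 \<le> j" "j < k" for j0 j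
    using that(2,1,3)
  proof (induction rule: dec_induct)
    case (step j)
    then show ?case
      using assms(3)[of j] by (auto simp: cyc_shift_def)
  qed
  have "k - 1 \<in> T"
    using up[OF i(1)] i(2) by simp
  then have "0 \<in> T"
    using step[of "k - 1"] i(2) by (auto simp: cyc_shift_def)
  then show ?thesis
    using up[of 0] by auto
qed

text \<open>
  If a permutation of a cycle moves every point by at most one step and is not a rotation by one
  step, then it is a product of disjoint transpositions: a point moved forward without its
  successor moving back pushes the successor forward as well, and so on all the way round.
\<close>

lemma near_permutation_cases:
  assumes f: "f permutes {..<k}"
    and near: "\<And>i. i < k \<Longrightarrow> f i = i \<or> f i = cyc_shift k i \<or> cyc_shift k (f i) = i"
  shows "f = cyc_shift k \<or> Hilbert_Choice.inv f = cyc_shift k \<or> (\<forall>i. f (f i) = i)"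
proof -
  let ?c = "cyc_shift k"
  have c: "?c permutes {..<k}"
    by (rule cyc_shift_permutes)
  have forward: "g = ?c"
    if g: "g permutes {..<k}"
      and g_near: "\<And>i. i < k \<Longrightarrow> g i = i \<or> g i = ?c i \<or> ?c (g i) = i"
      and i0: "i0 < k" "g i0 = ?c i0" "g (?c i0) \<noteq> i0" for g i0
  proof -
    have ginj: "g x = g y \<Longrightarrow> x = y" and cinj: "?c x = ?c y \<Longrightarrow> x = y" for x y
      using permutes_inj[OF g] permutes_inj[OF c] by (auto dest: injD)
    let ?T = "{i. g i = ?c i \<and> g (?c i) \<noteq> i}"
    have "{..<k} \<subseteq> ?T"
    proof (rule cyc_shift_closed)
      show "i0 \<in> ?T"
        using i0 by simp
    next
      fix i assume i: "i \<in> ?T" "i < k"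
      then have gi: "g i = ?c i" "g (?c i) \<noteq> i" by auto
      have cik: "?c i < k"
        using i(2) by (auto simp: cyc_shift_def)
      show "?c i \<in> ?T"
      proof (cases "?c i = i")
        case True
        then show ?thesis using gi by simp
      next
        case False
        have "g (?c i) \<noteq> ?c i"
          using gi(1) ginj False by metis
        then have 1: "g (?c i) = ?c (?c i)"
          using g_near[OF cik] gi(2) cinj by blast
        moreover have "g (?c (?c i)) \<noteq> ?c i"
          using gi(1) ginj 1 gi(2) by metis
        ultimately show ?thesis by simp
      qed
    qed (use i0 in auto)
    then have "g i = ?c i" if "i < k" for i
      using that by blast
    moreover have "g i = ?c i" if "\<not> i < k" for i
      using that permutes_not_in[OF g] permutes_not_in[OF c] by simp
    ultimately show "g = ?c"
      by blast
  qed
  have finv: "Hilbert_Choice.inv f permutes {..<k}"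
    using f by (rule permutes_inv)
  have inv_near: "Hilbert_Choice.inv f i = i \<or> Hilbert_Choice.inv f i = ?c i \<or> ?c (Hilbert_Choice.inv f i) = i" if "i < k" for i
  proof -
    have "Hilbert_Choice.inv f i < k" "f (Hilbert_Choice.inv f i) = i"
      using that permutes_in_image[OF finv] permutes_inverses(1)[OF f] by auto
    then show ?thesis
      using near[of "Hilbert_Choice.inv f i"] by auto
  qed
  show ?thesis
  proof (rule ccontr)
    assume neg: "\<not> ?thesis"
    have A: "f (?c i) = i" if "i < k" "f i = ?c i" for i
      using forward[OF f near] that neg by blast
    have B: "Hilbert_Choice.inv f (?c i) = i" if "i < k" "Hilbert_Choice.inv f i = ?c i" for i
      using forward[OF finv inv_near] that neg by blast
    have "f (f i) = i" for i
    proof (cases "i < k")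
      case False
      then show ?thesis using permutes_not_in[OF f] by simp
    next
      case True
      have fk: "f i < k"
        using permutes_in_image[OF f] True by simp
      consider "f i = i" | "f i = ?c i" | "?c (f i) = i"
        using near[OF True] by blast
      then show ?thesis
      proof cases
        case 3
        then have "Hilbert_Choice.inv f i = f i" if "Hilbert_Choice.inv f (f i) = ?c (f i)"
          using B[OF fk that] by simp
        moreover have "Hilbert_Choice.inv f (f i) = ?c (f i)"
          using 3 permutes_inverses(2)[OF f] by simp
        ultimately show ?thesis
          using permutes_inverses(1)[OF f] by metis
      qed (use A True in auto)
    qed
    then show False using neg by blast
  qed
qed


text \<open>
  When the nonzero off-diagonal entries join neighbours on a cycle only, \<open>near_permutation_cases\<close>
  leaves three kinds of terms in the determinant: the cycle, its reverse (a permutation of the same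
  sign), and involutions. The involutions contribute equally to both determinants.
\<close>

lemma chordless_cycle_sum:
  fixes A B :: "nat \<Rightarrow> nat \<Rightarrow> 'a :: field"
  assumes k: "3 \<le> k"
    and det: "det (mat k k (\<lambda>(i, j). A i j)) = det (mat k k (\<lambda>(i, j). B i j))"
    and chord: "\<And>i j. i < k \<Longrightarrow> j < k \<Longrightarrow> i \<noteq> j \<Longrightarrow> cyc_shift k i \<noteq> j \<Longrightarrow> cyc_shift k j \<noteq> i \<Longrightarrow>
      A i j = 0 \<and> B i j = 0"
    and diag: "\<And>i. i < k \<Longrightarrow> A i i = B i i"
    and two: "\<And>i j. i < k \<Longrightarrow> j < k \<Longrightarrow> i \<noteq> j \<Longrightarrow> A i j * A j i = B i j * B j i"
  shows "(\<Prod>i<k. A i (cyc_shift k i)) + (\<Prod>i<k. A (cyc_shift k i) i) =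
    (\<Prod>i<k. B i (cyc_shift k i)) + (\<Prod>i<k. B (cyc_shift k i) i)"
proof -
  let ?c = "cyc_shift k"
  let ?c' = "Hilbert_Choice.inv ?c"
  let ?P = "{p. p permutes {..<k}}"
  let ?R = "?P - {?c, ?c'}"
  define t where "t M p = signof p * (\<Prod>i<k. M i (p i))" for M :: "nat \<Rightarrow> nat \<Rightarrow> 'a" and p
  have c: "?c permutes {..<k}" by (rule cyc_shift_permutes)
  have c': "?c' permutes {..<k}" using c by (rule permutes_inv)
  \<comment> \<open>length at least three is what makes the cycle differ from its reverse\<close>
  have "?c 0 = 1" "?c 1 = 2"
    using k by (auto simp: cyc_shift_def)
  then have ne: "?c \<noteq> ?c'"
    using permutes_inverses(2)[OF c, of 0] by auto
  have sgn: "sign ?c' = sign ?c"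
    using c by (intro sign_inverse) (auto intro: permutation_permutes[THEN iffD2])
  have expand: "det (mat k k (\<lambda>(i, j). M i j)) = t M ?c + t M ?c' + (\<Sum>p\<in>?R. t M p)"
    for M :: "nat \<Rightarrow> nat \<Rightarrow> 'a"
  proof -
    have "det (mat k k (\<lambda>(i, j). M i j)) = (\<Sum>p\<in>?P. t M p)"
      unfolding t_def lessThan_atLeast0
      by (subst det_def'[of _ k])
        (auto intro!: sum.cong prod.cong simp: permutes_in_image[of _ "{0..<k}"] dest: permutes_in_image)
    also have "\<dots> = (\<Sum>p\<in>{?c, ?c'}. t M p) + (\<Sum>p\<in>?R. t M p)"
      using c c' by (subst sum.subset_diff[of "{?c, ?c'}"]) (auto simp: finite_permutations add.commute)
    finally show ?thesis using ne by simp
  qed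
  have rest: "t A p = t B p" if "p \<in> ?R" for p
  proof -
    have p: "p permutes {..<k}" and pc: "p \<noteq> ?c" "p \<noteq> ?c'"
      using that by auto
    have pk: "p i < k" if "i < k" for i
      using permutes_in_image[OF p] that by simp
    show ?thesis
    proof (cases "\<forall>i<k. p i = i \<or> p i = ?c i \<or> ?c (p i) = i")
      case True
      moreover have "Hilbert_Choice.inv p \<noteq> ?c"
        using pc(2) permutes_inv_inv[OF p] by metis
      ultimately have "p (p i) = i" for i
        using near_permutation_cases[OF p] pc(1) by blast
      then have "(\<Prod>i<k. A i (p i)) = (\<Prod>i<k. B i (p i))"
        using diag two by (intro prod_involution[OF p]) auto
      then show ?thesis by (simp add: t_def)
    next
      case False
      then obtain i where i: "i < k" "p i \<noteq> i" "p i \<noteq> ?c i" "?c (p i) \<noteq> i"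
        by auto
      then have "A i (p i) = 0" "B i (p i) = 0"
        using chord[OF i(1) pk[OF i(1)]] by auto
      then have "(\<Prod>i<k. A i (p i)) = 0" "(\<Prod>i<k. B i (p i)) = 0"
        using i(1) by (auto intro!: prod_zero)
      then show ?thesis unfolding t_def by (simp only:)
    qed
  qed
  have inv_prod: "(\<Prod>i<k. M i (?c' i)) = (\<Prod>i<k. M (?c i) i)" for M :: "nat \<Rightarrow> nat \<Rightarrow> 'a"
    using permutes_in_image[OF c] permutes_in_image[OF c'] permutes_inverses[OF c]
    by (intro prod.reindex_bij_witness[where i = ?c and j = ?c']) auto
  have "t A ?c + t A ?c' = t B ?c + t B ?c'"
    using det rest unfolding expand by simp
  then have "signof ?c * ((\<Prod>i<k. A i (?c i)) + (\<Prod>i<k. A (?c i) i)) =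
      signof ?c * ((\<Prod>i<k. B i (?c i)) + (\<Prod>i<k. B (?c i) i))"
    by (simp add: t_def sgn inv_prod ring_distribs)
  then show ?thesis
    by (auto simp: sign_def split: if_splits)
qed

lemma double_root:
  fixes P Q c :: "'a :: field"
  assumes "P + Q = c + c" and "P * Q = c * c"
  shows "P = c"
proof -
  have "(P - c) * (P - c) = P * P - P * (c + c) + c * c"
    by (simp add: algebra_simps)
  also have "\<dots> = 0"
    unfolding assms(1)[symmetric] assms(2)[symmetric] by (simp add: algebra_simps)
  finally show ?thesis by simp
qed

section \<open>Cycle products are determined by principal minors\<close>

text \<open>
  Principal submatrices are indexed by lists rather than sets, so that the order of the rows can be
  chosen to follow a cycle.
\<close>

definition list_mat :: "(nat \<Rightarrow> nat \<Rightarrow> 'a) \<Rightarrow> nat list \<Rightarrow> 'a mat" where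
  "list_mat M xs = mat (length xs) (length xs) (\<lambda>(i, j). M (xs ! i) (xs ! j))"

lemma list_mat_carrier [simp]: "list_mat M xs \<in> carrier_mat (length xs) (length xs)"
  and dim_list_mat [simp]: "dim_row (list_mat M xs) = length xs" "dim_col (list_mat M xs) = length xs"
  and list_mat_index [simp]:
    "i < length xs \<Longrightarrow> j < length xs \<Longrightarrow> list_mat M xs $$ (i, j) = M (xs ! i) (xs ! j)"
  by (auto simp: list_mat_def)

lemma det_list_mat_1: "det (list_mat M [i]) = M i i"
  by (subst det_single) (auto simp: list_mat_def)

lemma det_list_mat_2:
  fixes M :: "nat \<Rightarrow> nat \<Rightarrow> 'a :: field"
  shows "det (list_mat M [i, j]) = M i i * M j j - M i j * M j i"
proof -
  have "det (list_mat M [i, j]) = (\<Sum>r<2. list_mat M [i, j] $$ (r, 0) * cofactor (list_mat M [i, j]) r 0)"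
    by (rule laplace_expansion_column) (auto simp: list_mat_def)
  also have "\<dots> = M i i * M j j - M i j * M j i"
    by (auto simp: numeral_2_eq_2 cofactor_def list_mat_def mat_delete_def det_single)
  finally show ?thesis .
qed

definition same_minors_on :: "nat set \<Rightarrow> (nat \<Rightarrow> nat \<Rightarrow> 'a :: field) \<Rightarrow> (nat \<Rightarrow> nat \<Rightarrow> 'a) \<Rightarrow> bool" where
  "same_minors_on X A B \<longleftrightarrow>
     (\<forall>xs. distinct xs \<and> set xs \<subseteq> X \<longrightarrow> det (list_mat A xs) = det (list_mat B xs))"

lemma same_minors_diag:
  assumes "same_minors_on X A B" and "i \<in> X"
  shows "A i i = B i i"
  using assms det_list_mat_1[of A i] det_list_mat_1[of B i]
  by (auto simp: same_minors_on_def dest!: spec[of _ "[i]"])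

lemma same_minors_two:
  assumes "same_minors_on X A B" and "i \<in> X" "j \<in> X"
  shows "A i j * A j i = B i j * B j i"
proof (cases "i = j")
  case False
  then have "det (list_mat A [i, j]) = det (list_mat B [i, j])"
    using assms by (auto simp: same_minors_on_def)
  then show ?thesis
    using assms by (simp add: det_list_mat_2 same_minors_diag)
qed (use assms in \<open>simp add: same_minors_diag\<close>)

text \<open>
  A chord closes both arcs of the cycle into shorter cycles, and is used once in each direction.
\<close>

lemma cycle_prod_chord:
  "cycle_prod M (u # ps @ v # qs) * (M u v * M v u) = cycle_prod M (u # ps @ [v]) * cycle_prod M (v # qs @ [u])"
  using walk_prod_split[of M "u # ps" v "qs @ [u]"] walk_prod_split[of M "u # ps" v "[u]"]
    walk_prod_split[of M "v # qs" u "[v]"]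
  by (simp add: cycle_prod_def ac_simps)

lemma walk_prod_times_reverse:
  fixes A B :: "nat \<Rightarrow> nat \<Rightarrow> 'a :: field"
  assumes sym: "\<And>i j. i \<in> X \<Longrightarrow> j \<in> X \<Longrightarrow> A i j = A j i"
    and minors: "same_minors_on X A B" and xs: "set xs \<subseteq> X"
  shows "walk_prod B xs * walk_prod (\<lambda>i j. B j i) xs = walk_prod A xs * walk_prod A xs"
proof -
  have "walk_prod (\<lambda>i j. B i j * B j i) xs = walk_prod (\<lambda>i j. A i j * A i j) xs"
    using xs by (rule walk_prod_cong) (metis same_minors_two[OF minors] sym)
  then show ?thesis by (simp add: walk_prod_mult)
qed

text \<open>
  The induction runs over all cycles, including those with vanishing entries. If a chord \<open>u v\<close> has
  \<open>A u v = 0\<close> but \<open>B u v\<close> or \<open>B v u\<close> is nonzero, one of the two shorter cycles shows that an arc of the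
  cycle has product zero in \<open>B\<close>. Then \<open>P = 0\<close>, and \<open>P * P' = c * c\<close> forces \<open>c = 0\<close>. This excludes the
  one-way edges that \<open>B\<close> may have outside the graph of \<open>A\<close> from all cycles.
\<close>

lemma cycle_prod_eq_simple:
  fixes A B :: "nat \<Rightarrow> nat \<Rightarrow> 'a :: field"
  assumes sym: "\<And>i j. i \<in> X \<Longrightarrow> j \<in> X \<Longrightarrow> A i j = A j i"
    and minors: "same_minors_on X A B"
    and "distinct xs" "set xs \<subseteq> X" "xs \<noteq> []"
  shows "cycle_prod B xs = cycle_prod A xs"
  using assms(3-5)
proof (induction xs rule: length_induct)
  case (1 xs)
  note IH = 1(1)[rule_format] and dist = 1(2) and sub = 1(3)
  let ?k = "length xs"
  let ?c = "cyc_shift ?k"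
  have inX: "xs ! i \<in> X" if "i < ?k" for i
    using that sub by auto
  define P P' c where "P = (\<Prod>i<?k. B (xs ! i) (xs ! ?c i))"
    and "P' = (\<Prod>i<?k. B (xs ! ?c i) (xs ! i))" and "c = (\<Prod>i<?k. A (xs ! i) (xs ! ?c i))"
  have cyc: "cycle_prod B xs = P" "cycle_prod A xs = c"
    by (auto simp: P_def c_def cycle_prod_nth cyc_shift_def)
  have ck: "?c i < ?k" if "i < ?k" for i
    using that permutes_in_image[OF cyc_shift_permutes] by simp
  have PP': "P * P' = c * c"
    unfolding P_def P'_def c_def prod.distrib[symmetric]
    by (rule prod.cong) (auto simp: inX ck same_minors_two[OF minors, symmetric] sym)
  show ?case
  proof (cases "\<exists>i j. i < ?k \<and> j < ?k \<and> i \<noteq> j \<and> ?c i \<noteq> j \<and> ?c j \<noteq> i \<and>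
      (A (xs ! i) (xs ! j) \<noteq> 0 \<or> B (xs ! i) (xs ! j) \<noteq> 0)")
    case True
    then obtain u v where uv: "u < ?k" "v < ?k" "u < v" "?c u \<noteq> v" "?c v \<noteq> u"
      and chord: "A (xs ! u) (xs ! v) \<noteq> 0 \<or> B (xs ! u) (xs ! v) \<noteq> 0 \<or> B (xs ! v) (xs ! u) \<noteq> 0"
      using sym inX by (metis linorder_less_linear)
    define x y where "x = xs ! u" and "y = xs ! v"
    define ps qs rs where "ps = take u xs" and "qs = take (v - Suc u) (drop (Suc u) xs)"
      and "rs = drop (Suc v) xs"
    have split: "xs = ps @ x # qs @ y # rs"
    proof -
      have "xs = take u xs @ xs ! u # drop (Suc u) xs"
        using uv(1) by (rule id_take_nth_drop)
      moreover have "drop (Suc u) xs = qs @ y # rs"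
        using uv id_take_nth_drop[of "v - Suc u" "drop (Suc u) xs"]
        by (simp add: qs_def rs_def y_def)
      ultimately show ?thesis by (simp add: ps_def x_def)
    qed
    have len: "length qs = v - Suc u" "length ps = u" "length rs = ?k - Suc v"
      using uv by (auto simp: ps_def qs_def rs_def)
    have "v \<noteq> Suc u"
      using uv by (auto simp: cyc_shift_def)
    then have qs: "0 < length qs"
      using uv len by auto
    have "\<not> (u = 0 \<and> Suc v = ?k)"
      using uv by (auto simp: cyc_shift_def)
    then have rsps: "0 < length (rs @ ps)"
      using uv(2) by (simp only: length_append len) arith
    \<comment> \<open>rotate the cycle so that it starts at one end of the chord\<close>
    have rot: "cycle_prod M xs = cycle_prod M (x # qs @ y # rs @ ps)" for M :: "nat \<Rightarrow> nat \<Rightarrow> 'a"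
      unfolding split using cycle_prod_rotate[of M ps "x # qs @ y # rs"] by simp
    have xy: "x \<in> X" "y \<in> X"
      using inX uv by (auto simp: x_def y_def)
    have IH1: "cycle_prod B (x # qs @ [y]) = cycle_prod A (x # qs @ [y])"
      using rsps dist sub by (intro IH) (auto simp: split)
    have IH2: "cycle_prod B (y # (rs @ ps) @ [x]) = cycle_prod A (y # (rs @ ps) @ [x])"
      using qs dist sub by (intro IH) (auto simp: split)
    have AA: "B x y * B y x = A x y * A x y"
      using same_minors_two[OF minors xy] sym[OF xy] by simp
    have ch: "cycle_prod M xs * (M x y * M y x) =
        cycle_prod M (x # qs @ [y]) * cycle_prod M (y # (rs @ ps) @ [x])" for M :: "nat \<Rightarrow> nat \<Rightarrow> 'a"
      unfolding rot using cycle_prod_chord[of M x qs y "rs @ ps"] by simp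
    have "P * (A x y * A x y) = c * (A x y * A x y)"
      using ch[of A] ch[of B] IH1 IH2 AA sym[OF xy] cyc by simp
    moreover have "P = c" if "A x y = 0"
    proof -
      have A0: "cycle_prod A (x # qs @ [y]) = 0" "cycle_prod A (y # (rs @ ps) @ [x]) = 0"
        using walk_prod_split[of A "x # qs" y "[x]"] walk_prod_split[of A "y # rs @ ps" x "[y]"]
          that sym[OF xy] by (auto simp: cycle_prod_def)
      have "walk_prod B (x # qs @ [y]) * B y x = 0" "walk_prod B (y # (rs @ ps) @ [x]) * B x y = 0"
        using A0 IH1 IH2 walk_prod_split[of B "x # qs" y "[x]"] walk_prod_split[of B "y # rs @ ps" x "[y]"]
        by (auto simp: cycle_prod_def)
      moreover have "B x y \<noteq> 0 \<or> B y x \<noteq> 0"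
        using chord that by (auto simp: x_def y_def)
      moreover have "cycle_prod B xs = walk_prod B (x # qs @ [y]) * walk_prod B (y # (rs @ ps) @ [x])"
        unfolding rot using walk_prod_split[of B "x # qs" y "rs @ ps @ [x]"] by (simp add: cycle_prod_def)
      ultimately have "P = 0"
        using cyc by auto
      then show ?thesis using PP' by simp
    qed
    ultimately show ?thesis
      using cyc by auto
  next
    case False
    show ?thesis
    proof (cases "3 \<le> ?k")
      case True
      have "P + P' = c + (\<Prod>i<?k. A (xs ! ?c i) (xs ! i))"
        unfolding P_def P'_def c_def
      proof (rule chordless_cycle_sum[OF True, symmetric])
        show "det (mat ?k ?k (\<lambda>(i, j). A (xs ! i) (xs ! j))) = det (mat ?k ?k (\<lambda>(i, j). B (xs ! i) (xs ! j)))"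
          using minors dist sub by (auto simp: same_minors_on_def list_mat_def)
      qed (use False inX minors in \<open>auto simp: same_minors_diag intro: same_minors_two\<close>)
      also have "(\<Prod>i<?k. A (xs ! ?c i) (xs ! i)) = c"
        unfolding c_def by (rule prod.cong) (auto simp: inX ck sym)
      finally show ?thesis
        using double_root PP' cyc by metis
    next
      case False
      then consider i where "xs = [i]" | i j where "xs = [i, j]"
        using 1(4) by (cases xs; cases "tl xs"; cases "tl (tl xs)") auto
      then show ?thesis
      proof cases
        case (1 i)
        then show ?thesis using sub minors by (simp add: cycle_prod_def same_minors_diag)
      next
        case (2 i j)
        then show ?thesis using sub same_minors_two[OF minors, of i j] by (simp add: cycle_prod_def)
      qed
    qed
  qed
qed


text \<open>Cutting a closed walk at a repeated vertex leaves two shorter closed walks.\<close>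

lemma walk_prod_eq_closed:
  fixes A B :: "nat \<Rightarrow> nat \<Rightarrow> 'a :: field"
  assumes sym: "\<And>i j. i \<in> X \<Longrightarrow> j \<in> X \<Longrightarrow> A i j = A j i"
    and minors: "same_minors_on X A B"
    and "set ws \<subseteq> X" "hd ws = last ws"
  shows "walk_prod B ws = walk_prod A ws"
proof -
  have cyc: "cycle_prod B xs = cycle_prod A xs" if "set xs \<subseteq> X" "xs \<noteq> []" for xs
    using that
  proof (induction xs rule: length_induct)
    case (1 xs)
    show ?case
    proof (cases "distinct xs")
      case True
      then show ?thesis using cycle_prod_eq_simple[OF sym minors] 1 by blast
    next
      case False
      then obtain ps qs rs v where xs: "xs = ps @ [v] @ qs @ [v] @ rs"
        using not_distinct_decomp by blast
      have "cycle_prod M xs = cycle_prod M (v # qs) * cycle_prod M (v # rs @ ps)" for M :: "nat \<Rightarrow> nat \<Rightarrow> 'a"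
        unfolding xs using cycle_prod_rotate[of M ps "v # qs @ v # rs"]
          walk_prod_split[of M "v # qs" v "rs @ ps @ [v]"]
        by (simp add: cycle_prod_def)
      moreover have "cycle_prod B (v # qs) = cycle_prod A (v # qs)"
        "cycle_prod B (v # rs @ ps) = cycle_prod A (v # rs @ ps)"
        using 1 by (auto simp: xs)
      ultimately show ?thesis by simp
    qed
  qed
  show ?thesis
  proof (cases ws rule: rev_cases)
    case (snoc xs x)
    then show ?thesis
      using assms(3,4) cyc[of xs] by (cases xs) (auto simp: cycle_prod_def)
  qed simp
qed

section \<open>Connected components and diagonal scaling\<close>

definition support_on :: "nat set \<Rightarrow> (nat \<Rightarrow> nat \<Rightarrow> 'a :: zero) \<Rightarrow> nat rel" where
  "support_on X M = {(i, j). i \<in> X \<and> j \<in> X \<and> M i j \<noteq> 0}"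

lemma reachable_imp_walk:
  fixes M :: "nat \<Rightarrow> nat \<Rightarrow> 'a :: field"
  assumes "(i, j) \<in> (support_on X M)\<^sup>*"
  shows "\<exists>ps. set ps \<subseteq> X \<and> hd (ps @ [j]) = i \<and> walk_prod M (ps @ [j]) \<noteq> 0"
  using assms
proof (induction rule: rtrancl_induct)
  case base
  show ?case by (rule exI[of _ "[]"]) simp
next
  case (step j k)
  then obtain ps where ps: "set ps \<subseteq> X" "hd (ps @ [j]) = i" "walk_prod M (ps @ [j]) \<noteq> 0"
    by blast
  have "hd ((ps @ [j]) @ [k]) = i"
    using ps(2) by (cases ps) auto
  then show ?case
    using ps step(2) walk_prod_split[of M ps j "[k]"]
    by (intro exI[of _ "ps @ [j]"]) (auto simp: support_on_def)
qed

lemma walk_imp_reachable: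
  fixes M :: "nat \<Rightarrow> nat \<Rightarrow> 'a :: field"
  assumes "walk_prod M xs \<noteq> 0" "set xs \<subseteq> X" "xs \<noteq> []"
  shows "(hd xs, last xs) \<in> (support_on X M)\<^sup>*"
  using assms
proof (induction xs rule: induct_list012)
  case (3 x y zs)
  then have "(x, y) \<in> support_on X M" "(y, last (y # zs)) \<in> (support_on X M)\<^sup>*"
    by (auto simp: support_on_def)
  then show ?case by (auto intro: converse_rtrancl_into_rtrancl)
qed auto

lemma support_rtrancl_sym:
  assumes "\<And>i j. i \<in> X \<Longrightarrow> j \<in> X \<Longrightarrow> M i j = M j i"
  shows "sym ((support_on X M)\<^sup>*)"
  using assms by (intro sym_rtrancl symI) (auto simp: support_on_def)

lemma support_rtrancl_in:
  "(i, j) \<in> (support_on X M)\<^sup>* \<Longrightarrow> i \<in> X \<longleftrightarrow> j \<in> X"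
  by (induction rule: rtrancl_induct) (auto simp: support_on_def)

text \<open>
  For each \<open>i\<close>, fix a walk from the root of its component to \<open>i\<close> with nonzero product \<open>wA i\<close> in \<open>A\<close> and
  product \<open>wB i\<close> in \<open>B\<close>. Going from the root to \<open>i\<close>, stepping to \<open>j\<close> and returning to the root is a
  closed walk, whatever the value of \<open>A i j\<close>; comparing its products in \<open>A\<close> and \<open>B\<close> shows that
  \<open>d i = wA i / wB i\<close> is the scaling.
\<close>

lemma same_minors_scaling:
  fixes A B :: "nat \<Rightarrow> nat \<Rightarrow> 'a :: field"
  assumes sym: "\<And>i j. i \<in> X \<Longrightarrow> j \<in> X \<Longrightarrow> A i j = A j i"
    and minors: "same_minors_on X A B"
  shows "\<exists>d. (\<forall>i\<in>X. d i \<noteq> 0) \<and>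
    (\<forall>i\<in>X. \<forall>j\<in>X. (i, j) \<in> (support_on X A)\<^sup>* \<longrightarrow> B i j = d i * A i j * inverse (d j))"
proof -
  let ?E = "(support_on X A)\<^sup>*"
  have symE: "(j, i) \<in> ?E" if "(i, j) \<in> ?E" for i j
    using that support_rtrancl_sym[of X A, OF sym] by (auto dest: symD)
  define root where "root i = (SOME r. (r, i) \<in> ?E)" for i
  have root: "(root i, i) \<in> ?E" for i
    unfolding root_def by (rule someI[of _ i]) simp
  have root_eq: "root i = root j" if "(i, j) \<in> ?E" for i j
  proof -
    have "(r, i) \<in> ?E \<longleftrightarrow> (r, j) \<in> ?E" for r
      using that symE rtrancl_trans by metis
    then show ?thesis by (simp add: root_def)
  qed
  have "\<exists>ps. set ps \<subseteq> X \<and> hd (ps @ [i]) = root i \<and> walk_prod A (ps @ [i]) \<noteq> 0" for i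
    using reachable_imp_walk[OF root] .
  then obtain w where w: "\<And>i. set (w i) \<subseteq> X" "\<And>i. hd (w i @ [i]) = root i"
    "\<And>i. walk_prod A (w i @ [i]) \<noteq> 0"
    by metis
  define wA wB wB' where "wA i = walk_prod A (w i @ [i])" and "wB i = walk_prod B (w i @ [i])"
    and "wB' i = walk_prod B (i # rev (w i))" for i
  have wX: "set (w i @ [i]) \<subseteq> X" if "i \<in> X" for i
    using w(1) that by simp
  have wA': "walk_prod A (i # rev (w i)) = wA i" if "i \<in> X" for i
    using walk_prod_rev[of A "w i @ [i]"] walk_prod_cong[OF wX[OF that], of A "\<lambda>i j. A j i"] sym
    by (simp add: wA_def)
  have wBB': "wB i * wB' i = wA i * wA i" if "i \<in> X" for i
    using walk_prod_times_reverse[OF sym minors wX[OF that]] walk_prod_rev[of B "w i @ [i]"]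
    by (simp add: wA_def wB_def wB'_def)
  have nz: "wA i \<noteq> 0" "wB i \<noteq> 0" if "i \<in> X" for i
    using wBB'[OF that] w(3)[of i] by (auto simp: wA_def)
  have "B i j = (wA i / wB i) * A i j * inverse (wA j / wB j)"
    if ij: "i \<in> X" "j \<in> X" "(i, j) \<in> ?E" for i j
  proof -
    let ?W = "(w i @ [i]) @ j # rev (w j)"
    have "last ?W = hd (rev (j # rev (w j)))"
      by (subst hd_rev) simp
    then have "hd ?W = last ?W"
      using w(2)[of i] w(2)[of j] root_eq[OF ij(3)] by (cases "w i") auto
    then have "walk_prod B ?W = walk_prod A ?W"
      using ij w(1)[of i] w(1)[of j] by (intro walk_prod_eq_closed[OF sym minors]) auto
    moreover have "walk_prod M ?W = walk_prod M (w i @ [i]) * M i j * walk_prod M (j # rev (w j))"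
      for M :: "nat \<Rightarrow> nat \<Rightarrow> 'a"
      using walk_prod_split[of M "w i" i "j # rev (w j)"] by (simp add: mult.assoc)
    ultimately have "wB i * B i j * wB' j = wA i * A i j * wA j"
      using wA'[OF ij(2)] by (simp add: wA_def wB_def wB'_def)
    then have "wB i * B i j * (wB j * wB' j) = wA i * A i j * wA j * wB j"
      by (metis mult.assoc mult.commute)
    then show ?thesis
      unfolding wBB'[OF ij(2)] using nz[OF ij(1)] nz[OF ij(2)] by (simp add: field_simps)
  qed
  then show ?thesis
    using nz by (intro exI[of _ "\<lambda>i. wA i / wB i"]) auto
qed

lemma support_mono_same_minors:
  fixes A B :: "nat \<Rightarrow> nat \<Rightarrow> 'a :: field"
  assumes sym: "\<And>i j. i \<in> X \<Longrightarrow> j \<in> X \<Longrightarrow> A i j = A j i"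
    and minors: "same_minors_on X A B" and "Y \<subseteq> X"
  shows "support_on Y A \<subseteq> support_on Y B"
proof -
  have "B i j \<noteq> 0" if "i \<in> X" "j \<in> X" "A i j \<noteq> 0" for i j
    using that same_minors_two[OF minors, of i j] sym[of i j] by auto
  then show ?thesis
    using assms(3) by (auto simp: support_on_def)
qed

lemma strongly_connected_same_minors:
  fixes A B :: "nat \<Rightarrow> nat \<Rightarrow> 'a :: field"
  assumes sym: "\<And>i j. i \<in> X \<Longrightarrow> j \<in> X \<Longrightarrow> A i j = A j i"
    and minors: "same_minors_on X A B" and X: "i \<in> X" "j \<in> X"
    and ij: "(i, j) \<in> (support_on X B)\<^sup>*" and ji: "(j, i) \<in> (support_on X B)\<^sup>*"
  shows "(i, j) \<in> (support_on X A)\<^sup>*"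
proof -
  obtain ps where ps: "set ps \<subseteq> X" "hd (ps @ [j]) = i" "walk_prod B (ps @ [j]) \<noteq> 0"
    using reachable_imp_walk[OF ij] by blast
  obtain qs where qs: "set qs \<subseteq> X" "hd (qs @ [i]) = j" "walk_prod B (qs @ [i]) \<noteq> 0"
    using reachable_imp_walk[OF ji] by blast
  have split: "walk_prod M (ps @ qs @ [i]) = walk_prod M (ps @ [j]) * walk_prod M (qs @ [i])"
    for M :: "nat \<Rightarrow> nat \<Rightarrow> 'a"
    using qs(2) walk_prod_split[of M ps j "tl (qs @ [i])"] by (cases qs) auto
  have "hd (ps @ qs @ [i]) = last (ps @ qs @ [i])"
    using ps(2) qs(2) by (cases ps) auto
  then have "walk_prod B (ps @ qs @ [i]) = walk_prod A (ps @ qs @ [i])"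
    using X ps(1) qs(1) by (intro walk_prod_eq_closed[OF sym minors]) auto
  then have "walk_prod A (ps @ [j]) \<noteq> 0"
    using split[of A] split[of B] ps(3) qs(3) by auto
  then show ?thesis
    using walk_imp_reachable[of A "ps @ [j]" X] ps X by simp
qed

section \<open>Block triangular scalings preserve principal minors\<close>

text \<open>
  The function \<open>\<beta>\<close> gives the block of an index. A permutation with a nonzero product in \<open>B\<close> never
  decreases \<open>\<beta>\<close>; as it preserves the sum of the values of \<open>\<beta>\<close>, it preserves \<open>\<beta>\<close> itself, and only
  the diagonal blocks contribute.
\<close>

lemma same_minors_triangular:
  fixes A B :: "nat \<Rightarrow> nat \<Rightarrow> 'a :: field" and \<beta> :: "nat \<Rightarrow> nat"
  assumes de: "\<And>i. i \<in> X \<Longrightarrow> d i * e i = 1"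
    and eq: "\<And>i j. i \<in> X \<Longrightarrow> j \<in> X \<Longrightarrow> \<beta> i = \<beta> j \<Longrightarrow> B i j = d i * A i j * e j"
    and B0: "\<And>i j. i \<in> X \<Longrightarrow> j \<in> X \<Longrightarrow> \<beta> j < \<beta> i \<Longrightarrow> B i j = 0"
    and A0: "\<And>i j. i \<in> X \<Longrightarrow> j \<in> X \<Longrightarrow> \<beta> i \<noteq> \<beta> j \<Longrightarrow> A i j = 0"
  shows "same_minors_on X A B"
  unfolding same_minors_on_def
proof (intro allI impI, elim conjE)
  fix xs assume xs: "set xs \<subseteq> X"
  let ?k = "length xs"
  have inX: "xs ! i \<in> X" if "i < ?k" for i
    using that xs by auto
  have "(\<Prod>i=0..<?k. list_mat A xs $$ (i, p i)) = (\<Prod>i=0..<?k. list_mat B xs $$ (i, p i))"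
    if p: "p permutes {0..<?k}" for p
  proof -
    have pk: "p i < ?k" if "i < ?k" for i
      using permutes_in_image[OF p] that by auto
    have entry: "(\<Prod>i=0..<?k. list_mat M xs $$ (i, p i)) = (\<Prod>i=0..<?k. M (xs ! i) (xs ! p i))"
      for M :: "nat \<Rightarrow> nat \<Rightarrow> 'a"
      by (rule prod.cong) (auto simp: pk)
    have perm: "sum (\<lambda>i. \<beta> (xs ! p i)) {0..<?k} = sum (\<lambda>i. \<beta> (xs ! i)) {0..<?k}"
      using sum.permute[OF p, of "\<lambda>i. \<beta> (xs ! i)"] by (simp add: o_def)
    show ?thesis
    proof (cases "\<forall>i<?k. \<beta> (xs ! i) = \<beta> (xs ! p i)")
      case True
      have "(\<Prod>i=0..<?k. B (xs ! i) (xs ! p i)) =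
          (\<Prod>i=0..<?k. d (xs ! i) * A (xs ! i) (xs ! p i) * e (xs ! p i))"
        using True by (intro prod.cong) (auto simp: eq inX pk)
      also have "\<dots> = (\<Prod>i=0..<?k. d (xs ! i)) * (\<Prod>i=0..<?k. A (xs ! i) (xs ! p i)) *
          (\<Prod>i=0..<?k. e (xs ! p i))"
        by (simp add: prod.distrib)
      also have "(\<Prod>i=0..<?k. e (xs ! p i)) = (\<Prod>i=0..<?k. e (xs ! i))"
        using prod.permute[OF p, of "\<lambda>i. e (xs ! i)"] by (simp add: o_def)
      also have "(\<Prod>i=0..<?k. d (xs ! i)) * (\<Prod>i=0..<?k. A (xs ! i) (xs ! p i)) *
          (\<Prod>i=0..<?k. e (xs ! i)) =
          (\<Prod>i=0..<?k. d (xs ! i) * e (xs ! i)) * (\<Prod>i=0..<?k. A (xs ! i) (xs ! p i))"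
        by (simp add: prod.distrib ac_simps)
      also have "(\<Prod>i=0..<?k. d (xs ! i) * e (xs ! i)) = 1"
        by (rule prod.neutral) (auto simp: de inX)
      finally show ?thesis by (simp add: entry)
    next
      case False
      then obtain i where i: "i < ?k" "\<beta> (xs ! i) \<noteq> \<beta> (xs ! p i)" by auto
      have "A (xs ! i) (xs ! p i) = 0"
        using i by (intro A0) (auto simp: inX pk)
      then have "(\<Prod>i=0..<?k. A (xs ! i) (xs ! p i)) = 0"
        using i(1) by (intro prod_zero) auto
      moreover have "\<exists>i<?k. \<beta> (xs ! p i) < \<beta> (xs ! i)"
      proof (rule ccontr)
        assume "\<not> ?thesis"
        then have le: "\<beta> (xs ! i) \<le> \<beta> (xs ! p i)" if "i < ?k" for i
          using that by (metis not_less)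
        have "\<beta> (xs ! i) < \<beta> (xs ! p i)"
          using le[OF i(1)] i(2) by simp
        then have "sum (\<lambda>i. \<beta> (xs ! i)) {0..<?k} < sum (\<lambda>i. \<beta> (xs ! p i)) {0..<?k}"
          using i(1) le by (intro sum_strict_mono_ex1) auto
        then show False using perm by simp
      qed
      then obtain i' where "i' < ?k" "B (xs ! i') (xs ! p i') = 0"
        using B0 inX pk by metis
      then have "(\<Prod>i=0..<?k. B (xs ! i) (xs ! p i)) = 0"
        by (intro prod_zero) auto
      ultimately show ?thesis unfolding entry by (simp only:)
    qed
  qed
  then show "det (list_mat A xs) = det (list_mat B xs)"
    by (subst (1 2) det_def'[of _ ?k]) (auto intro!: sum.cong)
qed

section \<open>The fiber in terms of index lists\<close>

text \<open>Permuting rows and columns simultaneously multiplies the determinant by a square of a sign.\<close>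

lemma det_list_mat_mset:
  fixes M :: "nat \<Rightarrow> nat \<Rightarrow> 'a :: field"
  assumes "mset xs = mset ys"
  shows "det (list_mat M xs) = det (list_mat M ys)"
proof -
  obtain p where p: "p permutes {..<length ys}" "permute_list p ys = xs"
    using mset_eq_permutation[OF assms] .
  let ?k = "length ys"
  have p0: "p permutes {0..<?k}"
    using p(1) by (simp add: lessThan_atLeast0)
  have len: "length xs = ?k"
    using p(2) by auto
  have nth: "xs ! i = ys ! p i" if "i < ?k" for i
    using permute_list_nth[OF p(1) that] p(2) by simp
  have pk: "p i < ?k" if "i < ?k" for i
    using permutes_in_image[OF p(1)] that by simp
  define N where "N = mat ?k ?k (\<lambda>(i, j). M (ys ! i) (xs ! j))"
  have N: "N \<in> carrier_mat ?k ?k" by (simp add: N_def)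
  \<comment> \<open>\<open>N\<close> has permuted columns only; it is reached from \<open>list_mat M ys\<close> by permuting rows of transposes\<close>
  let ?L = "transpose_mat (list_mat M ys)"
  have "list_mat M xs = mat ?k ?k (\<lambda>(i, j). N $$ (p i, j))"
    by (rule eq_matI) (auto simp: N_def len nth pk)
  then have 1: "det (list_mat M xs) = signof p * det N"
    using det_permute_rows[OF N p0] by simp
  have "transpose_mat N = mat ?k ?k (\<lambda>(i, j). ?L $$ (p i, j))"
    by (rule eq_matI) (auto simp: N_def nth pk)
  then have "det (transpose_mat N) = signof p * det ?L"
    using det_permute_rows[OF _ p0, of ?L] by simp
  then have "det N = signof p * det (list_mat M ys)"
    using det_transpose[OF N] det_transpose[of "list_mat M ys" ?k] by simp
  then show ?thesis
    using 1 by (simp add: sign_def)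
qed

definition entries :: "'a mat \<Rightarrow> nat \<Rightarrow> nat \<Rightarrow> 'a" where
  "entries A i j = A $$ (i, j)"

lemma submatrix_eq_list_mat:
  assumes "S \<subseteq> {..<n}"
  obtains xs where "distinct xs" "set xs = S"
    "\<And>A. A \<in> carrier_mat n n \<Longrightarrow> submatrix A S S = list_mat (entries A) xs"
proof
  let ?xs = "map (pick S) [0..<card S]"
  have fin: "finite S"
    using assms finite_subset by blast
  show dist: "distinct ?xs"
    by (auto simp: distinct_map inj_on_def) (metis linorder_neqE_nat nat_neq_iff pick_mono_le)
  have "set ?xs \<subseteq> S"
    by (auto simp: pick_in_set_le)
  moreover have "card (set ?xs) = card S"
    using distinct_card[OF dist] by simp
  ultimately show "set ?xs = S"
    using fin by (simp add: card_subset_eq)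
  have "{i. i < n \<and> i \<in> S} = S"
    using assms by auto
  then show "submatrix A S S = list_mat (entries A) ?xs" if "A \<in> carrier_mat n n" for A :: "'b mat"
    using that by (intro eq_matI) (auto simp: submatrix_def entries_def)
qed

lemma mem_fiber_iff:
  assumes A: "A \<in> carrier_mat n n"
  shows "B \<in> fiber A \<longleftrightarrow> B \<in> carrier_mat n n \<and> same_minors_on {..<n} (entries A) (entries B)"
proof (cases "B \<in> carrier_mat n n")
  case B: True
  have "(\<forall>S. S \<subseteq> {..<n} \<longrightarrow> det (submatrix B S S) = det (submatrix A S S)) \<longleftrightarrow>
      same_minors_on {..<n} (entries A) (entries B)" (is "?L \<longleftrightarrow> ?R")
  proof
    assume L: ?L
    show ?R
      unfolding same_minors_on_def
    proof (intro allI impI, elim conjE)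
      fix xs assume xs: "distinct xs" "set xs \<subseteq> {..<n}"
      obtain ys where ys: "distinct ys" "set ys = set xs"
        "\<And>A :: 'a mat. A \<in> carrier_mat n n \<Longrightarrow> submatrix A (set xs) (set xs) = list_mat (entries A) ys"
        using submatrix_eq_list_mat[OF xs(2)] by metis
      have "mset xs = mset ys"
        using xs ys by (simp add: set_eq_iff_mset_eq_distinct)
      then show "det (list_mat (entries A) xs) = det (list_mat (entries B) xs)"
        using L xs(2) ys(3)[OF A] ys(3)[OF B] by (metis det_list_mat_mset)
    qed
  next
    assume R: ?R
    show ?L
    proof (intro allI impI)
      fix S :: "nat set" assume S: "S \<subseteq> {..<n}"
      obtain xs where "distinct xs" "set xs = S"
        "\<And>A :: 'a mat. A \<in> carrier_mat n n \<Longrightarrow> submatrix A S S = list_mat (entries A) xs"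
        using submatrix_eq_list_mat[OF S] by metis
      then show "det (submatrix B S S) = det (submatrix A S S)"
        using R S A B by (auto simp: same_minors_on_def)
    qed
  qed
  then show ?thesis
    using A B by (auto simp: fiber_def principal_minor_map_def fun_eq_iff restrict_def)
qed (use A in \<open>auto simp: fiber_def\<close>)

section \<open>Diagonal equivalence entrywise\<close>

lemma diagonal_mult_index:
  fixes D X :: "'a :: field mat"
  assumes "D \<in> carrier_mat n n" "X \<in> carrier_mat n n" "diagonal_mat D" "i < n" "j < n"
  shows "(D * X) $$ (i, j) = D $$ (i, i) * X $$ (i, j)" and "(X * D) $$ (i, j) = X $$ (i, j) * D $$ (j, j)"
proof -
  have "(D * X) $$ (i, j) = (\<Sum>k=0..<n. D $$ (i, k) * X $$ (k, j))"
    using assms by (simp add: scalar_prod_def)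
  also have "\<dots> = (\<Sum>k=0..<n. if k = i then D $$ (i, i) * X $$ (i, j) else 0)"
    using assms by (intro sum.cong) (auto simp: diagonal_mat_def)
  finally show "(D * X) $$ (i, j) = D $$ (i, i) * X $$ (i, j)"
    using assms by simp
  have "(X * D) $$ (i, j) = (\<Sum>k=0..<n. X $$ (i, k) * D $$ (k, j))"
    using assms by (simp add: scalar_prod_def)
  also have "\<dots> = (\<Sum>k=0..<n. if k = j then X $$ (i, j) * D $$ (j, j) else 0)"
    using assms by (intro sum.cong) (auto simp: diagonal_mat_def)
  finally show "(X * D) $$ (i, j) = X $$ (i, j) * D $$ (j, j)"
    using assms by simp
qed

lemma diagonally_equivalent_iff:
  fixes A B :: "'a :: field mat"
  assumes A: "A \<in> carrier_mat n n" and sym: "transpose_mat A = A"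
  shows "diagonally_equivalent B A \<longleftrightarrow> B \<in> carrier_mat n n \<and>
    (\<exists>d e. (\<forall>i<n. d i * e i = 1) \<and> (\<forall>i<n. \<forall>j<n. B $$ (i, j) = d i * A $$ (i, j) * e j))"
proof
  assume "diagonally_equivalent B A"
  then obtain m D E where 1: "{B, A, D, E} \<subseteq> carrier_mat m m" "diagonal_mat D" "inverts_mat D E"
    "B = D * A * E"
    unfolding diagonally_equivalent_def sym by auto
  have "m = n"
    using A 1(1) by auto
  then have c: "B \<in> carrier_mat n n" "D \<in> carrier_mat n n" "E \<in> carrier_mat n n"
    using 1(1) by auto
  have DE: "D $$ (i, i) * E $$ (i, j) = (if i = j then 1 else 0)" if "i < n" "j < n" for i j
    using diagonal_mult_index(1)[OF c(2,3) 1(2) that, symmetric] 1(3) c that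
    by (simp add: inverts_mat_def del: index_mult_mat(1))
  then have "D $$ (i, i) \<noteq> 0" if "i < n" for i
    using that by fastforce
  then have "diagonal_mat E"
    using DE c by (fastforce simp: diagonal_mat_def)
  then have "B $$ (i, j) = D $$ (i, i) * A $$ (i, j) * E $$ (j, j)" if "i < n" "j < n" for i j
    unfolding 1(4) using that A c diagonal_mult_index(1)[OF c(2) A 1(2) that]
      diagonal_mult_index(2)[OF c(3), of "D * A" i j] by simp
  then show "B \<in> carrier_mat n n \<and>
      (\<exists>d e. (\<forall>i<n. d i * e i = 1) \<and> (\<forall>i<n. \<forall>j<n. B $$ (i, j) = d i * A $$ (i, j) * e j))"
    using c DE by (intro conjI exI[of _ "\<lambda>i. D $$ (i, i)"] exI[of _ "\<lambda>i. E $$ (i, i)"]) auto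
next
  assume "B \<in> carrier_mat n n \<and>
    (\<exists>d e. (\<forall>i<n. d i * e i = 1) \<and> (\<forall>i<n. \<forall>j<n. B $$ (i, j) = d i * A $$ (i, j) * e j))"
  then obtain d e where B: "B \<in> carrier_mat n n" and de: "\<And>i. i < n \<Longrightarrow> d i * e i = 1"
    and BA: "\<And>i j. i < n \<Longrightarrow> j < n \<Longrightarrow> B $$ (i, j) = d i * A $$ (i, j) * e j" by blast
  define D E where "D = mat n n (\<lambda>(i, j). if i = j then d i else 0)"
    and "E = mat n n (\<lambda>(i, j). if i = j then e i else 0)"
  have D: "D \<in> carrier_mat n n" "diagonal_mat D" and E: "E \<in> carrier_mat n n" "diagonal_mat E"
    by (auto simp: D_def E_def diagonal_mat_def)
  have "inverts_mat D E" "inverts_mat E D"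
    unfolding inverts_mat_def using D(1) E(1) de
    by (auto intro!: eq_matI simp: diagonal_mult_index(1)[OF D(1) E(1) D(2)]
        diagonal_mult_index(1)[OF E(1) D(1) E(2)] simp del: index_mult_mat(1))
      (auto simp: D_def E_def mult.commute)
  moreover have "B = D * A * E"
  proof (rule eq_matI)
    fix i j assume "i < dim_row (D * A * E)" "j < dim_col (D * A * E)"
    then have ij: "i < n" "j < n" using D E by auto
    have "(D * A * E) $$ (i, j) = D $$ (i, i) * A $$ (i, j) * E $$ (j, j)"
      using diagonal_mult_index(2)[OF E(1) mult_carrier_mat[OF D(1) A] E(2) ij]
        diagonal_mult_index(1)[OF D(1) A D(2) ij] by (simp only:)
    then show "B $$ (i, j) = (D * A * E) $$ (i, j)"
      using ij BA by (simp only:) (simp add: D_def E_def)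
  qed (use B D E in auto)
  ultimately show "diagonally_equivalent B A"
    unfolding diagonally_equivalent_def using A B D E by blast
qed


section \<open>Block triangular form along a list of index lists\<close>

lemma list_mat_append:
  "list_mat M (xs @ ys) = four_block_mat (list_mat M xs)
     (mat (length xs) (length ys) (\<lambda>(i, j). M (xs ! i) (ys ! j)))
     (mat (length ys) (length xs) (\<lambda>(i, j). M (ys ! i) (xs ! j))) (list_mat M ys)"
  by (rule eq_matI) (auto simp: nth_append)

lemma block_upper_triangular_list_mat:
  fixes M :: "nat \<Rightarrow> nat \<Rightarrow> 'a :: field"
  assumes "sorted_wrt (\<lambda>xs ys. \<forall>x\<in>set xs. \<forall>y\<in>set ys. M y x = 0) Cs"
  shows "block_upper_triangular (map (list_mat M) Cs) (list_mat M (concat Cs))"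
  using assms
proof (induction Cs)
  case (Cons C Cs)
  have "mat (length (concat Cs)) (length C) (\<lambda>(i, j). M (concat Cs ! i) (C ! j)) =
      0\<^sub>m (length (concat Cs)) (length C)"
  proof (rule eq_matI)
    fix i j assume ij: "i < dim_row (0\<^sub>m (length (concat Cs)) (length C) :: 'a mat)"
      "j < dim_col (0\<^sub>m (length (concat Cs)) (length C) :: 'a mat)"
    then have "concat Cs ! i \<in> set (concat Cs)" "C ! j \<in> set C"
      by (auto simp del: set_concat)
    then have "M (concat Cs ! i) (C ! j) = 0"
      using Cons.prems by auto
    then show "mat (length (concat Cs)) (length C) (\<lambda>(i, j). M (concat Cs ! i) (C ! j)) $$ (i, j) =
      0\<^sub>m (length (concat Cs)) (length C) $$ (i, j)"
      using ij by simp
  qed auto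
  then have "list_mat M (concat (C # Cs)) = four_block_mat (list_mat M C)
      (mat (length C) (length (concat Cs)) (\<lambda>(i, j). M (C ! i) (concat Cs ! j)))
      (0\<^sub>m (length (concat Cs)) (length C)) (list_mat M (concat Cs))"
    by (simp add: list_mat_append)
  moreover have "block_upper_triangular (map (list_mat M) Cs) (list_mat M (concat Cs))"
    using Cons by simp
  ultimately show ?case
    unfolding list.map block_upper_triangular.simps dim_list_mat
    by (intro exI[of _ "list_mat M (concat Cs)"] conjI
        exI[of _ "mat (length C) (length (concat Cs)) (\<lambda>(i, j). M (C ! i) (concat Cs ! j))"])
      (auto simp del: concat.simps)
qed (auto simp: list_mat_def)

lemma diag_block_list_mat:
  fixes M :: "nat \<Rightarrow> nat \<Rightarrow> 'a :: field"
  assumes "sorted_wrt (\<lambda>xs ys. \<forall>x\<in>set xs. \<forall>y\<in>set ys. M y x = 0 \<and> M x y = 0) Cs"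
  shows "diag_block_mat (map (list_mat M) Cs) = list_mat M (concat Cs)"
  using assms
proof (induction Cs)
  case (Cons C Cs)
  have 0: "M (concat Cs ! i) (C ! j) = 0 \<and> M (C ! j) (concat Cs ! i) = 0"
    if "i < length (concat Cs)" "j < length C" for i j
  proof -
    have "concat Cs ! i \<in> set (concat Cs)" "C ! j \<in> set C"
      using that by (auto simp del: set_concat)
    then show ?thesis using Cons.prems by auto
  qed
  have "mat (length (concat Cs)) (length C) (\<lambda>(i, j). M (concat Cs ! i) (C ! j)) =
      0\<^sub>m (length (concat Cs)) (length C)"
    "mat (length C) (length (concat Cs)) (\<lambda>(i, j). M (C ! i) (concat Cs ! j)) =
      0\<^sub>m (length C) (length (concat Cs))"
    using 0 by (auto intro!: eq_matI)
  then show ?case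
    using Cons by (simp add: list_mat_append Let_def)
qed (auto simp: list_mat_def)

lemma block_offset_Cons: "block_offset (B # Bs) (Suc i) = dim_row B + block_offset Bs i"
  and block_offset_0 [simp]: "block_offset Bs 0 = 0"
  by (auto simp: block_offset_def)

lemma block_offset_list_mat:
  "block_offset (map (list_mat M) Cs) i = length (concat (take i Cs))"
  by (simp add: block_offset_def take_map length_concat o_def)

lemma concat_nth_offset:
  assumes "i < length Cs" "r < length (Cs ! i)"
  shows "length (concat (take i Cs)) + r < length (concat Cs)"
    and "concat Cs ! (length (concat (take i Cs)) + r) = Cs ! i ! r"
proof -
  have "concat Cs = concat (take i Cs) @ Cs ! i @ concat (drop (Suc i) Cs)"
    using id_take_nth_drop[OF assms(1)] by (metis concat.simps(2) concat_append)
  then show "length (concat (take i Cs)) + r < length (concat Cs)"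
    and "concat Cs ! (length (concat (take i Cs)) + r) = Cs ! i ! r"
    using assms(2) by (auto simp: nth_append)
qed

lemma block_upper_triangular_entries:
  fixes M :: "'a :: field mat"
  assumes "block_upper_triangular Bs M" "proper_blocks Bs"
  shows "M \<in> carrier_mat (sum_list (map dim_row Bs)) (sum_list (map dim_row Bs))"
    and "i < length Bs \<Longrightarrow> r < dim_row (Bs ! i) \<Longrightarrow> block_offset Bs i + r < sum_list (map dim_row Bs)"
    and "i < length Bs \<Longrightarrow> r < dim_row (Bs ! i) \<Longrightarrow> t < dim_row (Bs ! i) \<Longrightarrow>
      M $$ (block_offset Bs i + r, block_offset Bs i + t) = (Bs ! i) $$ (r, t)"
    and "i < length Bs \<Longrightarrow> j < i \<Longrightarrow> r < dim_row (Bs ! i) \<Longrightarrow> t < dim_row (Bs ! j) \<Longrightarrow>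
      M $$ (block_offset Bs i + r, block_offset Bs j + t) = 0"
  using assms
proof (induction Bs arbitrary: M i j r t)
  case (Cons B Bs)
  have step: "\<exists>X N. block_upper_triangular Bs N \<and> proper_blocks Bs \<and> dim_col B = dim_row B \<and>
      N \<in> carrier_mat (sum_list (map dim_row Bs)) (sum_list (map dim_row Bs)) \<and>
      M = four_block_mat B X (0\<^sub>m (dim_row N) (dim_col B)) N"
    if Bs: "block_upper_triangular (B # Bs) M" "proper_blocks (B # Bs)" for M
  proof -
    obtain X N where "block_upper_triangular Bs N" "M = four_block_mat B X (0\<^sub>m (dim_row N) (dim_col B)) N"
      using Bs(1) unfolding block_upper_triangular.simps by blast
    moreover have "proper_blocks Bs" "dim_col B = dim_row B"
      using Bs(2) by (auto simp: proper_blocks_def)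
    ultimately show ?thesis
      using Cons.IH(1) by blast
  qed
  have offset: "block_offset (B # Bs) i + r < sum_list (map dim_row (B # Bs))"
    if "i < length (B # Bs)" "r < dim_row ((B # Bs) ! i)"
      "block_upper_triangular (B # Bs) M" "proper_blocks (B # Bs)" for M i r
    using that(1,2) step[OF that(3,4)] Cons.IH(2)[of "i - 1" r]
    by (cases i) (auto simp: block_offset_Cons)
  {
    case 1
    then show ?case
      using step[OF 1] by auto
  next
    case 2
    then show ?case by (rule offset)
  next
    case 3
    obtain X N where N: "block_upper_triangular Bs N" "proper_blocks Bs" "dim_col B = dim_row B"
      "N \<in> carrier_mat (sum_list (map dim_row Bs)) (sum_list (map dim_row Bs))"
      and M: "M = four_block_mat B X (0\<^sub>m (dim_row N) (dim_col B)) N"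
      using step[OF 3(4,5)] by blast
    show ?case
    proof (cases i)
      case 0
      then show ?thesis using 3(1-3) N(3) by (simp add: M)
    next
      case (Suc i')
      then show ?thesis
        using 3(1-3) N(3,4) Cons.IH(2)[of i', OF _ _ N(1,2)] Cons.IH(3)[of i', OF _ _ _ N(1,2)]
        by (simp add: M block_offset_Cons add.assoc)
    qed
  next
    case (4 M i j r t)
    obtain X N where N: "block_upper_triangular Bs N" "proper_blocks Bs" "dim_col B = dim_row B"
      "N \<in> carrier_mat (sum_list (map dim_row Bs)) (sum_list (map dim_row Bs))"
      and M: "M = four_block_mat B X (0\<^sub>m (dim_row N) (dim_col B)) N"
      using step[OF 4(5,6)] by blast
    obtain i' where i: "i = Suc i'"
      using 4(2) by (cases i) auto
    have lt: "block_offset Bs i' + r < sum_list (map dim_row Bs)"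
      using 4(1,3) i Cons.IH(2)[of i', OF _ _ N(1,2)] by simp
    show ?case
    proof (cases j)
      case 0
      then show ?thesis using 4(4) N(3,4) i lt by (simp add: M block_offset_Cons add.assoc)
    next
      case (Suc j')
      then have "block_offset Bs j' + t < sum_list (map dim_row Bs)"
        using 4(1-4) i Cons.IH(2)[of j' t, OF _ _ N(1,2)] by simp
      then show ?thesis
        using 4(1-4) N(3,4) i Suc lt Cons.IH(4)[of i' j' r t, OF _ _ _ _ N(1,2)]
        by (simp add: M block_offset_Cons add.assoc)
    qed
  }
qed auto

section \<open>Irreducibility of connected blocks\<close>

text \<open>
  In a block upper triangular form, the indices outside the first block cannot be left along nonzero
  entries.
\<close>

lemma irreducible_if_connected:
  fixes A :: "'a :: field mat"
  assumes A: "A \<in> carrier_mat n n"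
    and conn: "\<And>i j. i < n \<Longrightarrow> j < n \<Longrightarrow> (i, j) \<in> (support_on {..<n} (entries A))\<^sup>*"
  shows "irreducible_mat A"
proof -
  have False
    if p: "p permutes {..<n}" and len: "2 \<le> length Bs" and proper: "proper_blocks Bs"
      and but: "block_upper_triangular Bs (permute_rows_cols p A)" for p Bs
  proof -
    obtain B B' Bs' where Bs: "Bs = B # B' # Bs'"
      using len by (cases Bs; cases "tl Bs") auto
    obtain X N where M: "permute_rows_cols p A = four_block_mat B X (0\<^sub>m (dim_row N) (dim_col B)) N"
      using but Bs by auto
    let ?b = "dim_row B"
    have b: "0 < ?b" "dim_col B = ?b" "0 < dim_row B'"
      using proper by (auto simp: Bs proper_blocks_def)
    have "dim_row (permute_rows_cols p A) = sum_list (map dim_row Bs)"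
      using block_upper_triangular_entries(1)[OF but proper] by auto
    then have n: "n = sum_list (map dim_row Bs)"
      using A by (simp add: permute_rows_cols_def)
    then have bn: "?b < n"
      using b by (simp add: Bs)
    have pn: "p i < n" if "i < n" for i
      using permutes_in_image[OF p] that by simp
    have "dim_row (permute_rows_cols p A) = ?b + dim_row N" "dim_col (permute_rows_cols p A) = ?b + dim_col N"
      using b by (auto simp: M)
    then have dimN: "n = ?b + dim_row N" "n = ?b + dim_col N"
      using A by (auto simp: permute_rows_cols_def)
    have zero: "A $$ (p i, p j) = 0" if "?b \<le> i" "i < n" "j < ?b" for i j
    proof -
      have "A $$ (p i, p j) = permute_rows_cols p A $$ (i, j)"
        using that A bn by (simp add: permute_rows_cols_def)
      also have "\<dots> = 0"
        unfolding M using that dimN b by auto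
      finally show ?thesis .
    qed
    have "y \<in> p ` {?b..<n}" if "(p ?b, y) \<in> (support_on {..<n} (entries A))\<^sup>*" for y
      using that
    proof (induction rule: rtrancl_induct)
      case base
      then show ?case using bn by auto
    next
      case (step y z)
      then obtain i where i: "y = p i" "?b \<le> i" "i < n" by auto
      have "z < n" "A $$ (y, z) \<noteq> 0"
        using step(2) by (auto simp: support_on_def entries_def)
      moreover obtain j where j: "z = p j" "j < n"
        using \<open>z < n\<close> permutes_image[OF p] by (metis imageE lessThan_iff)
      ultimately have "?b \<le> j"
        using zero i by (metis not_less)
      then show ?case using j by auto
    qed
    then have "p 0 \<in> p ` {?b..<n}"
      using conn pn bn by auto
    then show False
      using b by (auto simp: inj_eq[OF permutes_inj[OF p]])
  qed
  then show ?thesis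
    using A unfolding irreducible_mat_def reducible_mat_def by auto
qed

lemma irreducible_list_mat:
  fixes M :: "nat \<Rightarrow> nat \<Rightarrow> 'a :: field"
  assumes "distinct C" and conn: "\<And>x y. x \<in> set C \<Longrightarrow> y \<in> set C \<Longrightarrow> (x, y) \<in> (support_on (set C) M)\<^sup>*"
  shows "irreducible_mat (list_mat M C)"
proof (rule irreducible_if_connected[OF list_mat_carrier])
  let ?E = "(support_on {..<length C} (entries (list_mat M C)))\<^sup>*"
  fix i j assume ij: "i < length C" "j < length C"
  have "\<exists>j<length C. C ! j = y \<and> (i, j) \<in> ?E" if "(C ! i, y) \<in> (support_on (set C) M)\<^sup>*" for y
    using that
  proof (induction rule: rtrancl_induct)
    case base
    then show ?case using ij by auto
  next
    case (step y z)
    then obtain j where j: "j < length C" "C ! j = y" "(i, j) \<in> ?E" by blast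
    obtain k where k: "k < length C" "C ! k = z"
      using step(2) by (auto simp: support_on_def in_set_conv_nth)
    have "(j, k) \<in> support_on {..<length C} (entries (list_mat M C))"
      using j k step(2) by (auto simp: support_on_def entries_def)
    then show ?case using j(3) k by (blast intro: rtrancl_into_rtrancl)
  qed
  then obtain j' where "j' < length C" "C ! j' = C ! j" "(i, j') \<in> ?E"
    using conn[of "C ! i" "C ! j"] ij by force
  then show "(i, j) \<in> ?E"
    using assms(1) ij nth_eq_iff_index_eq by metis
qed

lemma permutes_list_nth:
  assumes "distinct xs" "set xs = {..<n}"
  shows "(\<lambda>i. if i < n then xs ! i else i) permutes {..<n}"
proof (rule bij_imp_permutes)
  have len: "length xs = n"
    using distinct_card[OF assms(1)] assms(2) by simp
  have "bij_betw ((!) xs) {..<n} {..<n}"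
    by (rule bij_betw_nth[OF assms(1)]) (simp_all only: assms(2) len)
  then show "bij_betw (\<lambda>i. if i < n then xs ! i else i) {..<n} {..<n}"
    by (rule bij_betw_cong[THEN iffD1, rotated]) simp
qed auto

lemma permute_rows_cols_list_mat:
  assumes "A \<in> carrier_mat n n" "length zs = n" "\<And>i. i < n \<Longrightarrow> p i = zs ! i"
  shows "permute_rows_cols p A = list_mat (entries A) zs"
  using assms by (intro eq_matI) (auto simp: permute_rows_cols_def entries_def)


section \<open>The fiber along a list of connected components\<close>

locale component_lists =
  fixes A :: "'a :: field mat" and n :: nat and Cs :: "nat list list"
  assumes carrier: "A \<in> carrier_mat n n"
    and symmetric: "transpose_mat A = A"
    and distinct_concat_Cs: "distinct (concat Cs)"
    and set_concat_Cs: "set (concat Cs) = {..<n}"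
    and nonempty: "[] \<notin> set Cs"
    and component_iff: "i < length Cs \<Longrightarrow> j < length Cs \<Longrightarrow> x \<in> set (Cs ! i) \<Longrightarrow> y \<in> set (Cs ! j) \<Longrightarrow>
      (x, y) \<in> (support_on {..<n} (entries A))\<^sup>* \<longleftrightarrow> i = j"
begin

abbreviation "a \<equiv> entries A"
abbreviation "s \<equiv> length Cs"
abbreviation "E \<equiv> (support_on {..<n} a)\<^sup>*"

text \<open>
  The permutation that lists the indices component by component, in the order of components given by
  \<open>\<tau>\<close>. Each component keeps its own internal order, which is what \<^const>\<open>blocks_at_same_indices\<close> asks
  for.
\<close>

definition order_of :: "(nat \<Rightarrow> nat) \<Rightarrow> nat \<Rightarrow> nat" where
  "order_of \<tau> i = (if i < n then concat (permute_list \<tau> Cs) ! i else i)"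

lemma entries_sym: "i \<in> {..<n} \<Longrightarrow> j \<in> {..<n} \<Longrightarrow> a i j = a j i"
  using carrier symmetric index_transpose_mat(1)[of i A j] by (auto simp: entries_def)

lemma in_component:
  assumes "i < s" "x \<in> set (Cs ! i)"
  shows "x < n"
proof -
  have "x \<in> set (concat Cs)"
    using assms by auto
  then show ?thesis
    by (simp only: set_concat_Cs lessThan_iff)
qed

lemma component_exists:
  assumes "x < n"
  shows "\<exists>i<s. \<exists>r<length (Cs ! i). x = Cs ! i ! r"
proof -
  have "x \<in> set (concat Cs)"
    using assms by (simp only: set_concat_Cs lessThan_iff)
  then obtain C where "C \<in> set Cs" "x \<in> set C"
    by auto
  then show ?thesis
    by (metis in_set_conv_nth)
qed

lemma entries_across:
  assumes "i < s" "j < s" "x \<in> set (Cs ! i)" "y \<in> set (Cs ! j)" "i \<noteq> j"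
  shows "a x y = 0"
proof (rule ccontr)
  assume "a x y \<noteq> 0"
  then have "(x, y) \<in> E"
    using in_component assms by (auto simp: support_on_def)
  then show False
    using component_iff assms by blast
qed

lemma list_mat_transpose:
  assumes "i < s"
  shows "transpose_mat (list_mat a (Cs ! i)) = list_mat a (Cs ! i)"
  using in_component[OF assms] by (intro eq_matI) (auto intro!: entries_sym)

lemma concat_permute_list:
  assumes "\<tau> permutes {..<s}"
  shows "distinct (concat (permute_list \<tau> Cs))" "set (concat (permute_list \<tau> Cs)) = {..<n}"
    "length (concat (permute_list \<tau> Cs)) = n"
proof -
  have "mset (concat (permute_list \<tau> Cs)) = mset (concat Cs)"
    using assms by (simp add: mset_concat flip: sum_mset_sum_list)
  then show "distinct (concat (permute_list \<tau> Cs))" "set (concat (permute_list \<tau> Cs)) = {..<n}"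
    using distinct_concat_Cs set_concat_Cs mset_eq_imp_distinct_iff mset_eq_setD by metis+
  then show "length (concat (permute_list \<tau> Cs)) = n"
    using distinct_card by fastforce
qed

lemma order_of_permutes:
  assumes "\<tau> permutes {..<s}"
  shows "order_of \<tau> permutes {..<n}"
  using permutes_list_nth[OF concat_permute_list(1,2)[OF assms]] unfolding order_of_def .

lemma permute_rows_cols_order_of:
  assumes "\<tau> permutes {..<s}" "B \<in> carrier_mat n n"
  shows "permute_rows_cols (order_of \<tau>) B = list_mat (entries B) (concat (permute_list \<tau> Cs))"
  using permute_rows_cols_list_mat[OF assms(2) concat_permute_list(3)[OF assms(1)]]
  by (simp add: order_of_def)

lemma order_of_offset:
  assumes \<tau>: "\<tau> permutes {..<s}" and i: "i < s" and r: "r < length (Cs ! \<tau> i)"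
  shows "order_of \<tau> (block_offset (map (list_mat M) (permute_list \<tau> Cs)) i + r) = Cs ! \<tau> i ! r"
proof -
  have "permute_list \<tau> Cs ! i = Cs ! \<tau> i"
    using permute_list_nth[OF \<tau> i] .
  then show ?thesis
    using concat_nth_offset[of i "permute_list \<tau> Cs" r] i r concat_permute_list(3)[OF \<tau>]
    by (simp add: order_of_def block_offset_list_mat)
qed

lemma component_irreducible:
  fixes b :: "nat \<Rightarrow> nat \<Rightarrow> 'a"
  assumes minors: "same_minors_on {..<n} a b" and i: "i < s"
  shows "irreducible_mat (list_mat b (Cs ! i))"
proof (rule irreducible_list_mat)
  let ?C = "set (Cs ! i)"
  show "distinct (Cs ! i)"
    using distinct_concat_Cs i by (auto simp: distinct_concat_iff)
  fix x y assume xy: "x \<in> ?C" "y \<in> ?C"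
  then have "(x, y) \<in> E"
    using component_iff i by blast
  then have "y \<in> ?C \<and> (x, y) \<in> (support_on ?C a)\<^sup>*"
  proof (induction rule: rtrancl_induct)
    case base
    then show ?case using xy by simp
  next
    case (step y z)
    then have z: "z < n" "a y z \<noteq> 0"
      by (auto simp: support_on_def)
    then obtain j where j: "j < s" "z \<in> set (Cs ! j)"
      using component_exists by (metis nth_mem)
    then have "z \<in> ?C"
      using entries_across[OF i j(1) _ j(2)] step z by blast
    then have "(y, z) \<in> support_on ?C a"
      using step z by (auto simp: support_on_def)
    then show ?case
      using step \<open>z \<in> ?C\<close> by auto
  qed
  moreover have "support_on ?C a \<subseteq> support_on ?C b"
    using in_component[OF i] by (intro support_mono_same_minors[OF entries_sym minors]) auto
  ultimately show "(x, y) \<in> (support_on ?C b)\<^sup>*"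
    using rtrancl_mono by blast
qed

text \<open>
  The components are sorted by the number \<open>\<kappa>\<close> of indices from which they can be reached in \<open>B\<close>. An
  entry of \<open>B\<close> leading back to an earlier component would give both components the same set of
  predecessors, hence put them into one strongly connected component of \<open>B\<close>. Components with equal
  \<open>\<kappa>\<close> may therefore stand in any order.
\<close>

lemma fiber_imp_block_form:
  assumes "B \<in> fiber A"
  shows "\<exists>q \<tau> Bs. q permutes {..<n} \<and> \<tau> permutes {..<s} \<and> length Bs = s \<and>
    proper_blocks Bs \<and> block_upper_triangular Bs (permute_rows_cols q B) \<and>
    blocks_at_same_indices (order_of id) (map (list_mat a) Cs) \<tau> q Bs \<and>
    (\<forall>i < s. irreducible_mat (Bs ! i) \<and> diagonally_equivalent (Bs ! i) (map (list_mat a) Cs ! \<tau> i))"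
proof -
  define b where "b = entries B"
  let ?EB = "(support_on {..<n} b)\<^sup>*"
  have B: "B \<in> carrier_mat n n" and minors: "same_minors_on {..<n} a b"
    using assms by (auto simp: mem_fiber_iff[OF carrier] b_def)
  obtain d where d: "\<And>i. i < n \<Longrightarrow> d i \<noteq> 0"
    "\<And>i j. i < n \<Longrightarrow> j < n \<Longrightarrow> (i, j) \<in> E \<Longrightarrow> b i j = d i * a i j * inverse (d j)"
    using same_minors_scaling[OF entries_sym minors] by auto
  have E_EB: "E \<subseteq> ?EB"
    by (intro rtrancl_mono support_mono_same_minors[OF entries_sym minors]) auto
  define \<kappa> where "\<kappa> i = card {k\<in>{..<n}. (k, hd (Cs ! i)) \<in> ?EB}" for i
  define ts where "ts = sort_key \<kappa> [0..<s]"
  have ts: "distinct ts" "set ts = {..<s}" "length ts = s" "sorted (map \<kappa> ts)"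
    by (auto simp: ts_def)
  define \<tau> where "\<tau> i = (if i < s then ts ! i else i)" for i
  have \<tau>: "\<tau> permutes {..<s}"
    using permutes_list_nth[OF ts(1,2)] unfolding \<tau>_def .
  have \<tau>s: "\<tau> i < s" if "i < s" for i
    using permutes_in_image[OF \<tau>] that by simp
  let ?Ds = "permute_list \<tau> Cs"
  let ?Bs = "map (list_mat b) ?Ds"
  have Ds: "?Ds ! i = Cs ! \<tau> i" if "i < s" for i
    using permute_list_nth[OF \<tau> that] .
  have hd: "hd (Cs ! i) \<in> set (Cs ! i)" if "i < s" for i
    using nonempty that by (metis hd_in_set nth_mem)
  have upper: "b y x = 0"
    if ij: "i < j" "j < s" and x: "x \<in> set (Cs ! \<tau> i)" and y: "y \<in> set (Cs ! \<tau> j)" for i j x y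
  proof (rule ccontr)
    assume nz: "b y x \<noteq> 0"
    let ?x = "hd (Cs ! \<tau> i)" and ?y = "hd (Cs ! \<tau> j)"
    have lt: "\<tau> i < s" "\<tau> j < s"
      using \<tau>s ij by auto
    have n: "x < n" "y < n" "?x < n" "?y < n"
      using in_component lt x y hd by blast+
    have "(?y, y) \<in> ?EB" "(x, ?x) \<in> ?EB"
      using component_iff[OF lt(2) lt(2) hd[OF lt(2)] y] component_iff[OF lt(1) lt(1) x hd[OF lt(1)]] E_EB
      by auto
    moreover have "(y, x) \<in> ?EB"
      using nz n by (auto simp: support_on_def)
    ultimately have yx: "(?y, ?x) \<in> ?EB"
      by auto
    have "\<kappa> (\<tau> i) \<le> \<kappa> (\<tau> j)"
      using sorted_nth_mono[OF ts(4), of i j] ij ts(3) by (simp add: \<tau>_def)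
    moreover have "{k\<in>{..<n}. (k, ?y) \<in> ?EB} \<subseteq> {k\<in>{..<n}. (k, ?x) \<in> ?EB}"
      using yx by auto
    ultimately have "{k\<in>{..<n}. (k, ?y) \<in> ?EB} = {k\<in>{..<n}. (k, ?x) \<in> ?EB}"
      unfolding \<kappa>_def by (intro card_seteq) auto
    then have "(?x, ?y) \<in> ?EB"
      using n by blast
    then have "(?x, ?y) \<in> E"
      using strongly_connected_same_minors[OF entries_sym minors] yx n by auto
    then have "\<tau> i = \<tau> j"
      using component_iff[OF lt hd[OF lt(1)] hd[OF lt(2)]] by blast
    then show False
      using permutes_inj[OF \<tau>] ij by (auto simp: inj_eq)
  qed
  have "sorted_wrt (\<lambda>xs ys. \<forall>x\<in>set xs. \<forall>y\<in>set ys. b y x = 0) ?Ds"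
    unfolding sorted_wrt_iff_nth_less using upper Ds by auto
  then have "block_upper_triangular ?Bs (list_mat b (concat ?Ds))"
    by (rule block_upper_triangular_list_mat)
  then have "block_upper_triangular ?Bs (permute_rows_cols (order_of \<tau>) B)"
    unfolding permute_rows_cols_order_of[OF \<tau> B] b_def .
  moreover have "proper_blocks ?Bs"
    using nonempty \<tau> by (auto simp: proper_blocks_def)
  moreover have "blocks_at_same_indices (order_of id) (map (list_mat a) Cs) \<tau> (order_of \<tau>) ?Bs"
    unfolding blocks_at_same_indices_def
  proof (intro allI impI conjI)
    fix i assume "i < length ?Bs"
    then have i: "i < s" by simp
    show "dim_row (?Bs ! i) = dim_row (map (list_mat a) Cs ! \<tau> i)"
      using i Ds \<tau>s by simp
    fix r assume "r < dim_row (?Bs ! i)"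
    then have "r < length (Cs ! \<tau> i)"
      using i Ds by simp
    then show "order_of \<tau> (block_offset ?Bs i + r) =
        order_of id (block_offset (map (list_mat a) Cs) (\<tau> i) + r)"
      using order_of_offset[OF \<tau> i] order_of_offset[OF permutes_id \<tau>s[OF i], of r a] by simp
  qed
  moreover have "irreducible_mat (?Bs ! i) \<and> diagonally_equivalent (?Bs ! i) (map (list_mat a) Cs ! \<tau> i)"
    if i: "i < s" for i
  proof -
    let ?C = "Cs ! \<tau> i"
    have C: "?C ! r < n" if "r < length ?C" for r
      using in_component[OF \<tau>s[OF i]] that by simp
    have "b (?C ! r) (?C ! t) = d (?C ! r) * a (?C ! r) (?C ! t) * inverse (d (?C ! t))"
      if "r < length ?C" "t < length ?C" for r t
      using that C component_iff[OF \<tau>s[OF i] \<tau>s[OF i]] by (intro d(2)) auto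
    then have "diagonally_equivalent (list_mat b ?C) (list_mat a ?C)"
      unfolding diagonally_equivalent_iff[OF list_mat_carrier list_mat_transpose[OF \<tau>s[OF i]]]
      using d(1) C by (intro conjI exI[of _ "\<lambda>r. d (?C ! r)"] exI[of _ "\<lambda>r. inverse (d (?C ! r))"]) auto
    then show ?thesis
      using component_irreducible[OF minors \<tau>s[OF i]] i Ds \<tau>s by simp
  qed
  ultimately show ?thesis
    using \<tau> order_of_permutes[OF \<tau>]
    by (intro exI[of _ "order_of \<tau>"] exI[of _ \<tau>] exI[of _ ?Bs]) simp
qed

text \<open>
  Every index \<open>y\<close> is located by its block \<open>\<beta> y\<close> in the form of \<open>B\<close> and its position \<open>\<rho> y\<close> therein; since
  the blocks of \<open>A\<close> and \<open>B\<close> sit at the same indices, the scalings of the single blocks combine to one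
  scaling of all indices.
\<close>

lemma block_form_imp_fiber:
  assumes B: "B \<in> carrier_mat n n" and q: "q permutes {..<n}" and \<tau>: "\<tau> permutes {..<s}"
    and len: "length Bs = s" and proper: "proper_blocks Bs"
    and upper: "block_upper_triangular Bs (permute_rows_cols q B)"
    and same: "blocks_at_same_indices (order_of id) (map (list_mat a) Cs) \<tau> q Bs"
    and equiv: "\<And>i. i < s \<Longrightarrow> diagonally_equivalent (Bs ! i) (map (list_mat a) Cs ! \<tau> i)"
  shows "B \<in> fiber A"
proof -
  let ?off = "block_offset Bs"
  have \<tau>s: "\<tau> i < s" if "i < s" for i
    using permutes_in_image[OF \<tau>] that by simp
  have dim: "dim_row (Bs ! i) = length (Cs ! \<tau> i)" if "i < s" for i
    using same that \<tau>s[OF that] by (auto simp: blocks_at_same_indices_def len)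
  have q_off: "q (?off i + r) = Cs ! \<tau> i ! r" if "i < s" "r < length (Cs ! \<tau> i)" for i r
    using same that dim order_of_offset[OF permutes_id \<tau>s[OF that(1)], of r a]
    by (auto simp: blocks_at_same_indices_def len)
  have "n = sum_list (map dim_row Bs)"
    using block_upper_triangular_entries(1)[OF upper proper] B by (auto simp: permute_rows_cols_def)
  then have off_n: "?off i + r < n" if "i < s" "r < length (Cs ! \<tau> i)" for i r
    using block_upper_triangular_entries(2)[OF upper proper, of i r] that dim len by simp
  have "\<exists>d e. (\<forall>r<length (Cs ! \<tau> i). d r * e r = 1) \<and> (\<forall>r<length (Cs ! \<tau> i). \<forall>t<length (Cs ! \<tau> i).
      Bs ! i $$ (r, t) = d r * a (Cs ! \<tau> i ! r) (Cs ! \<tau> i ! t) * e t)" if "i < s" for i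
    using equiv[OF that] \<tau>s[OF that]
      diagonally_equivalent_iff[OF list_mat_carrier list_mat_transpose[OF \<tau>s[OF that]], of "Bs ! i"]
    by simp
  then obtain d e where de: "\<And>i r. i < s \<Longrightarrow> r < length (Cs ! \<tau> i) \<Longrightarrow> d i r * e i r = 1"
    and scale: "\<And>i r t. i < s \<Longrightarrow> r < length (Cs ! \<tau> i) \<Longrightarrow> t < length (Cs ! \<tau> i) \<Longrightarrow>
      Bs ! i $$ (r, t) = d i r * a (Cs ! \<tau> i ! r) (Cs ! \<tau> i ! t) * e i t"
    by metis
  have "\<exists>i r. i < s \<and> r < length (Cs ! \<tau> i) \<and> y = Cs ! \<tau> i ! r" if yn: "y < n" for y
  proof -
    obtain j r where j: "j < s" "r < length (Cs ! j)" "y = Cs ! j ! r"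
      using component_exists[OF yn] by blast
    then obtain i where "i < s" "\<tau> i = j"
      using permutes_image[OF \<tau>] by (metis imageE lessThan_iff)
    then show ?thesis using j by blast
  qed
  then obtain \<beta> \<rho> where \<beta>: "\<And>y. y < n \<Longrightarrow> \<beta> y < s" "\<And>y. y < n \<Longrightarrow> \<rho> y < length (Cs ! \<tau> (\<beta> y))"
    and y: "\<And>y. y < n \<Longrightarrow> y = Cs ! \<tau> (\<beta> y) ! \<rho> y"
    by metis
  have pos: "permute_rows_cols q B $$ (?off (\<beta> y) + \<rho> y, ?off (\<beta> z) + \<rho> z) = entries B y z"
    if "y < n" "z < n" for y z
    using that B off_n q_off \<beta> y[symmetric] by (simp add: permute_rows_cols_def entries_def)
  have "same_minors_on {..<n} a (entries B)"
  proof (rule same_minors_triangular[where \<beta> = \<beta> and d = "\<lambda>y. d (\<beta> y) (\<rho> y)" and e = "\<lambda>y. e (\<beta> y) (\<rho> y)"])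
    fix u assume "u \<in> {..<n}"
    then show "d (\<beta> u) (\<rho> u) * e (\<beta> u) (\<rho> u) = 1"
      using \<beta> de by simp
  next
    fix u v assume uv: "u \<in> {..<n}" "v \<in> {..<n}"
    then have n: "u < n" "v < n" by auto
    note \<beta>uv = \<beta>(1)[OF n(1)] \<beta>(1)[OF n(2)] and \<rho>uv = \<beta>(2)[OF n(1)] \<beta>(2)[OF n(2)]
    show "entries B u v = d (\<beta> u) (\<rho> u) * a u v * e (\<beta> v) (\<rho> v)" if eq: "\<beta> u = \<beta> v"
    proof -
      have "entries B u v = Bs ! \<beta> u $$ (\<rho> u, \<rho> v)"
        using pos[OF n] block_upper_triangular_entries(3)[OF upper proper, of "\<beta> u" "\<rho> u" "\<rho> v"]
          \<beta>uv \<rho>uv dim len eq by simp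
      also have "\<dots> = d (\<beta> u) (\<rho> u) * a u v * e (\<beta> v) (\<rho> v)"
        using scale[OF \<beta>uv(1) \<rho>uv(1), of "\<rho> v"] \<rho>uv(2) y[OF n(1)] y[OF n(2)] eq by simp
      finally show ?thesis .
    qed
    show "entries B u v = 0" if "\<beta> v < \<beta> u"
      using pos[OF n] block_upper_triangular_entries(4)[OF upper proper _ that, of "\<rho> u" "\<rho> v"]
        \<beta>uv \<rho>uv dim len by simp
    show "a u v = 0" if "\<beta> u \<noteq> \<beta> v"
    proof (rule entries_across[OF \<tau>s[OF \<beta>uv(1)] \<tau>s[OF \<beta>uv(2)]])
      show "u \<in> set (Cs ! \<tau> (\<beta> u))" "v \<in> set (Cs ! \<tau> (\<beta> v))"
        using y[OF n(1)] y[OF n(2)] \<rho>uv by (metis nth_mem)+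
      show "\<tau> (\<beta> u) \<noteq> \<tau> (\<beta> v)"
        using that permutes_inj[OF \<tau>] by (simp add: inj_eq)
    qed
  qed
  then show ?thesis
    using B by (simp add: mem_fiber_iff[OF carrier])
qed

end

lemma component_lists_exist:
  fixes A :: "'a :: field mat"
  assumes A: "A \<in> carrier_mat n n" and sym: "transpose_mat A = A"
    and xy: "x < n" "y < n" "(x, y) \<notin> (support_on {..<n} (entries A))\<^sup>*"
  shows "\<exists>Cs. component_lists A n Cs \<and> 2 \<le> length Cs"
proof -
  let ?E = "(support_on {..<n} (entries A))\<^sup>*"
  have symE: "(j, i) \<in> ?E" if "(i, j) \<in> ?E" for i j
  proof -
    have "sym ?E"
      using A sym index_transpose_mat(1)[of _ A]
      by (intro support_rtrancl_sym) (auto simp: entries_def)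
    then show ?thesis using that by (auto dest: symD)
  qed
  define cls where "cls u = {v. v < n \<and> (u, v) \<in> ?E}" for u
  have cls_iff: "(u, v) \<in> ?E \<longleftrightarrow> cls u = cls v" if "v < n" for u v
  proof
    assume uv: "(u, v) \<in> ?E"
    have "(u, w) \<in> ?E \<longleftrightarrow> (v, w) \<in> ?E" for w
      using uv symE[OF uv] by (meson rtrancl_trans)
    then show "cls u = cls v"
      by (simp add: cls_def)
  next
    assume "cls u = cls v"
    moreover have "v \<in> cls v"
      using that by (simp add: cls_def)
    ultimately have "v \<in> cls u"
      by simp
    then show "(u, v) \<in> ?E"
      by (simp add: cls_def)
  qed
  obtain Ks where Ks: "distinct Ks" "set Ks = cls ` {..<n}"
    using finite_distinct_list[of "cls ` {..<n}"] by auto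
  define Cs where "Cs = map sorted_list_of_set Ks"
  have fin: "finite K" if "K \<in> set Ks" for K
    using that by (auto simp: Ks(2) cls_def)
  have set_Cs: "set (Cs ! i) = Ks ! i" if "i < length Ks" for i
    using that fin by (simp add: Cs_def)
  have in_cls: "cls u = Ks ! i" if i: "i < length Ks" and u: "u \<in> Ks ! i" for i u
  proof -
    obtain v where v: "Ks ! i = cls v" "v < n"
      using nth_mem[OF i] by (auto simp: Ks(2))
    have "u < n" "(v, u) \<in> ?E"
      using u by (simp_all add: v(1) cls_def)
    then show ?thesis
      using cls_iff[of u v] v(1) by simp
  qed
  have "component_lists A n Cs"
  proof
    show "distinct (concat Cs)"
    proof (rule distinct_concat)
      have "inj_on sorted_list_of_set (set Ks)"
        using fin by (metis inj_onI set_sorted_list_of_set)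
      then show "distinct Cs"
        using Ks(1) by (simp add: Cs_def distinct_map)
      show "distinct ys" if ys: "ys \<in> set Cs" for ys
        using ys by (auto simp: Cs_def)
      show "set ys \<inter> set zs = {}" if yz: "ys \<in> set Cs" "zs \<in> set Cs" "ys \<noteq> zs" for ys zs
      proof -
        obtain i j where ij: "i < length Ks" "j < length Ks" "ys = Cs ! i" "zs = Cs ! j"
          using yz(1,2) by (metis Cs_def in_set_conv_nth length_map)
        have "Ks ! i = Ks ! j" if "u \<in> set ys" "u \<in> set zs" for u
          using that ij set_Cs in_cls[of i u] in_cls[of j u] by simp
        moreover have "Ks ! i \<noteq> Ks ! j"
          using ij yz(3) by (auto simp: Cs_def)
        ultimately show ?thesis
          by blast
      qed
    qed
    show "set (concat Cs) = {..<n}"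
      using fin by (auto simp: Cs_def Ks(2)) (auto simp: cls_def)
    show "[] \<notin> set Cs"
    proof
      assume "[] \<in> set Cs"
      then obtain K where K: "K \<in> set Ks" "sorted_list_of_set K = []"
        by (auto simp: Cs_def)
      then have "K = {}"
        using fin set_sorted_list_of_set[of K] by simp
      then show False
        using K(1) by (auto simp: Ks(2) cls_def)
    qed
  next
    fix i j u v
    assume ij: "i < length Cs" "j < length Cs" and uv: "u \<in> set (Cs ! i)" "v \<in> set (Cs ! j)"
    have K: "i < length Ks" "j < length Ks" "u \<in> Ks ! i" "v \<in> Ks ! j"
      using ij uv set_Cs by (auto simp: Cs_def)
    have "v < n"
      using K(2,4) nth_mem[of j Ks] by (auto simp: Ks(2) cls_def)
    then have "(u, v) \<in> ?E \<longleftrightarrow> Ks ! i = Ks ! j"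
      using cls_iff in_cls K by simp
    then show "(u, v) \<in> ?E \<longleftrightarrow> i = j"
      using Ks(1) K by (simp add: nth_eq_iff_index_eq)
  qed (use A sym in auto)
  moreover have "2 \<le> length Cs"
  proof -
    have "cls x \<noteq> cls y"
      using cls_iff[OF xy(2)] xy(3) by blast
    then have "card {cls x, cls y} = 2" by simp
    moreover have "card {cls x, cls y} \<le> card (set Ks)"
      using xy by (intro card_mono) (auto simp: Ks(2))
    ultimately show ?thesis
      using distinct_card[OF Ks(1)] by (simp add: Cs_def)
  qed
  ultimately show ?thesis by blast
qed

lemma fiber_of_connected:
  fixes A :: "'a :: field mat"
  assumes A: "A \<in> carrier_mat n n" and sym: "transpose_mat A = A"
    and conn: "\<And>i j. i < n \<Longrightarrow> j < n \<Longrightarrow> (i, j) \<in> (support_on {..<n} (entries A))\<^sup>*"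
  shows "fiber A = {B. diagonally_equivalent B A}"
proof -
  have symA: "entries A i j = entries A j i" if "i \<in> {..<n}" "j \<in> {..<n}" for i j
    using A sym index_transpose_mat(1)[of i A j] that by (auto simp: entries_def)
  have "B \<in> fiber A \<longleftrightarrow> diagonally_equivalent B A" for B
    unfolding mem_fiber_iff[OF A] diagonally_equivalent_iff[OF A sym]
  proof (intro conj_cong refl iffI)
    assume minors: "same_minors_on {..<n} (entries A) (entries B)"
    obtain d where "\<forall>i\<in>{..<n}. d i \<noteq> 0"
      "\<forall>i\<in>{..<n}. \<forall>j\<in>{..<n}. (i, j) \<in> (support_on {..<n} (entries A))\<^sup>* \<longrightarrow>
        entries B i j = d i * entries A i j * inverse (d j)"
      using same_minors_scaling[OF symA minors] by blast
    then show "\<exists>d e. (\<forall>i<n. d i * e i = 1) \<and> (\<forall>i<n. \<forall>j<n. B $$ (i, j) = d i * A $$ (i, j) * e j)"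
      by (intro exI[of _ d] exI[of _ "\<lambda>i. inverse (d i)"]) (auto simp: conn entries_def)
  next
    assume "\<exists>d e. (\<forall>i<n. d i * e i = 1) \<and> (\<forall>i<n. \<forall>j<n. B $$ (i, j) = d i * A $$ (i, j) * e j)"
    then obtain d e where "\<And>i. i < n \<Longrightarrow> d i * e i = 1"
      "\<And>i j. i < n \<Longrightarrow> j < n \<Longrightarrow> B $$ (i, j) = d i * A $$ (i, j) * e j"
      by blast
    then show "same_minors_on {..<n} (entries A) (entries B)"
      by (intro same_minors_triangular[where d = d and e = e and \<beta> = "\<lambda>_. 0"]) (auto simp: entries_def)
  qed
  then show ?thesis by auto
qed

theorem mainTheorem2:
  fixes A :: "'a :: field mat" and n :: nat
  assumes "A \<in> carrier_mat n n"
    and "transpose_mat A = A"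
  shows
    "(irreducible_mat A \<and> fiber A = {B. diagonally_equivalent B A}) \<or>
     (\<exists>s p As. 2 \<le> s \<and> length As = s \<and> p permutes {..<n} \<and>
        proper_blocks As \<and> (\<forall>i < s. irreducible_mat (As ! i)) \<and>
        permute_rows_cols p A = diag_block_mat As \<and>
        fiber A = {B \<in> carrier_mat n n.
          \<exists>q \<tau> Bs. q permutes {..<n} \<and> \<tau> permutes {..<s} \<and> length Bs = s \<and>
            proper_blocks Bs \<and> block_upper_triangular Bs (permute_rows_cols q B) \<and>
            blocks_at_same_indices p As \<tau> q Bs \<and>
            (\<forall>i < s. irreducible_mat (Bs ! i) \<and>
               diagonally_equivalent (Bs ! i) (As ! \<tau> i))})"
proof (cases "\<forall>i<n. \<forall>j<n. (i, j) \<in> (support_on {..<n} (entries A))\<^sup>*")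
  case True
  then show ?thesis
    using irreducible_if_connected[OF assms(1)] fiber_of_connected[OF assms] by blast
next
  case False
  then obtain Cs where "component_lists A n Cs" and s: "2 \<le> length Cs"
    using component_lists_exist[OF assms] by blast
  then interpret component_lists A n Cs by simp
  let ?As = "map (list_mat a) Cs"
  have minors: "same_minors_on {..<n} a a"
    by (simp add: same_minors_on_def)
  have "proper_blocks ?As"
    using nonempty by (auto simp: proper_blocks_def)
  moreover have "permute_rows_cols (order_of id) A = diag_block_mat ?As"
  proof -
    have "sorted_wrt (\<lambda>xs ys. \<forall>x\<in>set xs. \<forall>y\<in>set ys. a y x = 0 \<and> a x y = 0) Cs"
      unfolding sorted_wrt_iff_nth_less
    proof (intro allI impI ballI)
      fix i j x y assume "i < j" "j < s" "x \<in> set (Cs ! i)" "y \<in> set (Cs ! j)"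
      then show "a y x = 0 \<and> a x y = 0"
        using entries_across[of i j x y] entries_across[of j i y x] by simp
    qed
    then show ?thesis
      using permute_rows_cols_order_of[OF permutes_id carrier] by (simp add: diag_block_list_mat)
  qed
  moreover have "\<forall>i<s. irreducible_mat (?As ! i)"
    using component_irreducible[OF minors] by simp
  moreover have "fiber A = {B \<in> carrier_mat n n.
      \<exists>q \<tau> Bs. q permutes {..<n} \<and> \<tau> permutes {..<s} \<and> length Bs = s \<and>
        proper_blocks Bs \<and> block_upper_triangular Bs (permute_rows_cols q B) \<and>
        blocks_at_same_indices (order_of id) ?As \<tau> q Bs \<and>
        (\<forall>i < s. irreducible_mat (Bs ! i) \<and> diagonally_equivalent (Bs ! i) (?As ! \<tau> i))}"
    (is "_ = ?F")
  proof (intro equalityI subsetI)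
    fix B assume B: "B \<in> fiber A"
    then show "B \<in> ?F"
      using fiber_imp_block_form[OF B] mem_fiber_iff[OF carrier] by blast
  next
    fix B assume "B \<in> ?F"
    then show "B \<in> fiber A"
      using block_form_imp_fiber by blast
  qed
  ultimately show ?thesis
    using s order_of_permutes[OF permutes_id]
    by (intro disjI2 exI[of _ s] exI[of _ "order_of id"] exI[of _ ?As]) simp
qed

end
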